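(* Suppose $\kappa\ge\max\{\tfrac32 m-1,\,2\}$ and $\|U^0\|_{\mathcal X}\le\sqrt m$. For fixed terminal time $T>0$, assume that the exact solution $U$ of $$U_t+\kappa U=\mathcal L U+\mathcal N[U],\quad t\in(0,T],\ \mathbf x\in\Omega,\qquad U|_{t=0}=U^0,$$ with the periodic boundary condition, belongs to $C^1([0,T];\mathcal X)$, and let $\{U^n\}_{n\ge0}$ be generated by the ETD1 scheme $$U^{n+1}=e^{(\mathcal L-\kappa)\tau}U^n+\int_0^\tau e^{(\mathcal L-\kappa)(\tau-s)}\mathcal N[U^n]\,ds,\qquad n\ge0.$$ Then $$\|U^n-U(t_n)\|_{\mathcal X}\le C\,m\Big(\frac{\kappa}{1+5m}+1\Big)e^{(1+5m)t_n}\,\tau$$ for every $\tau>0$ and every $n\ge 0$ with $t_n=n\tau\le T$, where the constant $C>0$ is the $C^1([0,T];\mathcal X)$-norm of $U$ and is independent of $\tau$.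
   Context: Let $m\ge2$ be an integer, $\Omega=[-\frac12,\frac12]^m$, $\varepsilon>0$ and $\kappa>0$ constants. $\|\cdot\|_F$ is the Frobenius norm on $\mathbb R^{m\times m}$. $\mathcal X$ is the Banach space of continuous $\mathbb R^{m\times m}$-valued functions on $\overline\Omega$ satisfying the periodic boundary condition (i.e. whose periodic extension to $\mathbb R^m$ is continuous), with norm $\|W\|_{\mathcal X}=\max_{\mathbf x\in\overline\Omega}\|W(\mathbf x)\|_F$. $\mathcal L=\varepsilon^2\Delta$ with periodic boundary condition, acting entrywise; $e^{t\mathcal L}=e^{t\varepsilon^2\Delta}$ ($t\ge0$) is the periodic heat semigroup on $\mathcal X$, acting entrywise, and $e^{(\mathcal L-\kappa)t}=e^{-\kappa t}e^{t\mathcal L}$. The nonlinearity acts pointwise: $\mathcal N[U]=\kappa U+f(U)$ with $f(U)=U-UU^{\mathrm T}U$. The exact solution is the unique $U\in C([0,T];\mathcal X)$ with $\|U(t)\|_{\mathcal X}\le\sqrt m$ for all $t\in[0,T]$ satisfying $U(t)=e^{t(\mathcal L-\kappa)}U^0+\int_0^te^{(t-s)(\mathcal L-\kappa)}\mathcal N[U(s)]\,ds$ for all $t\in[0,T]$. The $C^1([0,T];\mathcal X)$-norm is the usual one, $\max_{t\in[0,T]}\|U(t)\|_{\mathcal X}+\max_{t\in[0,T]}\|U'(t)\|_{\mathcal X}$. *)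

theory Defs
  imports "HOL-Analysis.Analysis"
begin

section \<open>The phase space of periodic continuous matrix fields\<close>

definition Omega :: "(real ^ 'm) set" where
  "Omega = cbox (\<chi> i. - 1/2) (\<chi> i. 1/2)"

text \<open>
  A continuous matrix field on \<open>Omega\<close> with continuous periodic extension is identified with
  that extension, a continuous function on the whole space with period 1 in every coordinate
  direction.
\<close>

typedef 'm X = "{W :: real ^ 'm::finite \<Rightarrow> real ^ 'm ^ 'm.
    continuous_on UNIV W \<and> (\<forall>x i. W (x + axis i 1) = W x)}"
  morphisms field Abs_X
proof
  show "(\<lambda>x. 0) \<in> {W :: real ^ 'm \<Rightarrow> real ^ 'm ^ 'm.
    continuous_on UNIV W \<and> (\<forall>x i. W (x + axis i 1) = W x)}" by simp
qed

setup_lifting type_definition_X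

lemma continuous_field: "continuous_on UNIV (field W)"
  using field[of W] by auto

lemma field_periodic: "field W (x + axis i 1) = field W x"
  using field[of W] by auto

text \<open>The norm of the type \<open>real ^ 'm ^ 'm\<close> is the Frobenius norm.\<close>

lemma norm_matrix_Frobenius:
  fixes A :: "real ^ 'n ^ 'k"
  shows "norm A = sqrt (\<Sum>i\<in>UNIV. \<Sum>j\<in>UNIV. (A $ i $ j)\<^sup>2)"
  by (simp add: norm_vec_def L2_set_def sum_nonneg)

lemma field_periodic_int:
  assumes "a \<in> \<int>"
  shows "field W (x + axis i a) = field W x"
proof -
  have nat: "field W (x + axis i (real n)) = field W x" for n x
  proof (induction n)
    case 0
    then show ?case by (simp add: axis_eq_0_iff[THEN iffD2])
  next
    case (Suc n)
    have "axis i (real (Suc n)) = axis i (real n) + axis i 1"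
      by (simp add: axis_def vec_eq_iff)
    then have "x + axis i (real (Suc n)) = (x + axis i (real n)) + axis i 1"
      by simp
    then show ?case using Suc by (metis field_periodic)
  qed
  from assms obtain k where k: "a = of_int k" by (auto elim: Ints_cases)
  show ?thesis
  proof (cases "k \<ge> 0")
    case True
    then have "a = real (nat k)" using k by simp
    then show ?thesis using nat by simp
  next
    case False
    define n where "n = nat (- k)"
    have "a = - real n" using k False by (simp add: n_def)
    then have "x = (x + axis i a) + axis i (real n)"
      by (simp add: axis_def vec_eq_iff)
    then show ?thesis using nat by metis
  qed
qed

lemma field_periodic_int_vec:
  assumes "\<And>i. a $ i \<in> \<int>"
  shows "field W (x + a) = field W x"
proof -
  have "field W (x + (\<Sum>i\<in>I. axis i (a $ i))) = field W x" if "finite I" for I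
    using that
  proof (induction I)
    case empty
    then show ?case by simp
  next
    case (insert j I)
    have "x + (\<Sum>i\<in>insert j I. axis i (a $ i))
        = (x + (\<Sum>i\<in>I. axis i (a $ i))) + axis j (a $ j)"
      using insert by (simp add: algebra_simps)
    then show ?case using insert field_periodic_int[OF assms[of j]] by metis
  qed
  moreover have "(\<Sum>i\<in>UNIV. axis i (a $ i)) = a"
    by (simp add: vec_eq_iff axis_def)
  ultimately show ?thesis by (metis finite)
qed

lemma field_from_Omega: "\<exists>y\<in>Omega. field W x = field W y"
proof -
  define a :: "real ^ 'a" where "a = (\<chi> i. - of_int \<lfloor>x $ i + 1/2\<rfloor>)"
  have "field W (x + a) = field W x"
    by (rule field_periodic_int_vec) (simp add: a_def)
  moreover have "x + a \<in> Omega"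
  proof -
    have "- 1/2 \<le> x $ i - of_int \<lfloor>x $ i + 1/2\<rfloor>
        \<and> x $ i - of_int \<lfloor>x $ i + 1/2\<rfloor> \<le> 1/2" for i
      by linarith
    then show ?thesis
      by (simp add: Omega_def mem_box_cart a_def)
  qed
  ultimately show ?thesis by metis
qed

lemma Omega_nonempty: "Omega \<noteq> {}"
proof -
  have "(0 :: real ^ 'm) \<in> Omega" by (simp add: Omega_def mem_box_cart)
  then show ?thesis by blast
qed

lemma bdd_above_field: "bdd_above ((\<lambda>x. norm (field W x)) ` Omega)"
proof -
  have "compact ((\<lambda>x. norm (field W x)) ` Omega)"
    unfolding Omega_def
    by (intro compact_continuous_image continuous_on_norm compact_cbox)
       (rule continuous_on_subset[OF continuous_field], simp)
  then show ?thesis by (intro bounded_imp_bdd_above compact_imp_bounded)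
qed

instantiation X :: (finite) real_normed_vector
begin

lift_definition zero_X :: "'a X" is "\<lambda>x. 0" by simp

lift_definition plus_X :: "'a X \<Rightarrow> 'a X \<Rightarrow> 'a X" is "\<lambda>V W x. V x + W x"
  by (auto intro: continuous_on_add)

lift_definition minus_X :: "'a X \<Rightarrow> 'a X \<Rightarrow> 'a X" is "\<lambda>V W x. V x - W x"
  by (auto intro: continuous_on_diff)

lift_definition uminus_X :: "'a X \<Rightarrow> 'a X" is "\<lambda>W x. - W x"
  by (auto intro: continuous_on_minus)

lift_definition scaleR_X :: "real \<Rightarrow> 'a X \<Rightarrow> 'a X" is "\<lambda>c W x. c *\<^sub>R W x"
  by (auto intro: continuous_on_scaleR)

definition norm_X :: "'a X \<Rightarrow> real" where
  "norm_X W = (SUP x\<in>Omega. norm (field W x))"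

definition sgn_X :: "'a X \<Rightarrow> 'a X" where
  "sgn_X W = inverse (norm W) *\<^sub>R W"

definition dist_X :: "'a X \<Rightarrow> 'a X \<Rightarrow> real" where
  "dist_X V W = norm (V - W)"

definition uniformity_X :: "('a X \<times> 'a X) filter" where
  "uniformity_X = (INF e\<in>{0 <..}. principal {(V, W). dist V W < e})"

definition open_X :: "'a X set \<Rightarrow> bool" where
  "open_X A \<longleftrightarrow> (\<forall>V\<in>A. eventually (\<lambda>(V', W). V' = V \<longrightarrow> W \<in> A) uniformity)"

lemma norm_field_le: "norm (field W x) \<le> norm W"
proof -
  obtain y where "y \<in> Omega" "field W x = field W y" using field_from_Omega by blast
  then show ?thesis unfolding norm_X_def using cSUP_upper[OF _ bdd_above_field] by metis
qed

lemma norm_X_le: "(\<And>x. norm (field W x) \<le> b) \<Longrightarrow> norm W \<le> b"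
  unfolding norm_X_def by (rule cSUP_least[OF Omega_nonempty])

lemma norm_X_attained: "\<exists>x\<in>Omega. norm W = norm (field W x)"
proof -
  have "continuous_on Omega (\<lambda>x. norm (field W x))"
    by (intro continuous_on_norm) (rule continuous_on_subset[OF continuous_field], simp)
  then obtain x where "x \<in> Omega" "\<forall>y\<in>Omega. norm (field W y) \<le> norm (field W x)"
    using continuous_attains_sup[of Omega "\<lambda>x. norm (field W x)"] Omega_nonempty
    by (auto simp: Omega_def)
  then show ?thesis
    by (metis norm_field_le norm_X_le field_from_Omega order_antisym)
qed

instance
proof
  fix a b c :: "'a X" and r s :: real
  show "a + b + c = a + (b + c)" by transfer (simp add: add.assoc)
  show "a + b = b + a" by transfer (simp add: add.commute)
  show "0 + a = a" by transfer simp
  show "- a + a = 0" by transfer simp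
  show "a - b = a + - b" by transfer simp
  show "r *\<^sub>R (a + b) = r *\<^sub>R a + r *\<^sub>R b" by transfer (simp add: scaleR_add_right)
  show "(r + s) *\<^sub>R a = r *\<^sub>R a + s *\<^sub>R a" by transfer (simp add: scaleR_add_left)
  show "r *\<^sub>R s *\<^sub>R a = (r * s) *\<^sub>R a" by transfer simp
  show "1 *\<^sub>R a = a" by transfer simp
  show "dist a b = norm (a - b)" by (rule dist_X_def)
  show "sgn a = inverse (norm a) *\<^sub>R a" by (rule sgn_X_def)
  show "uniformity = (INF e\<in>{0 <..}. principal {(V, W :: 'a X). dist V W < e})"
    by (rule uniformity_X_def)
  show "open A \<longleftrightarrow> (\<forall>V\<in>A. eventually (\<lambda>(V', W). V' = V \<longrightarrow> W \<in> A) uniformity)"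
    for A :: "'a X set" by (rule open_X_def)
  show "norm a = 0 \<longleftrightarrow> a = 0"
  proof
    assume "norm a = 0"
    then have "field a x = 0" for x using norm_field_le[of a x] by simp
    then show "a = 0" by (simp add: field_inject[symmetric] zero_X.rep_eq fun_eq_iff)
  next
    assume "a = 0"
    then show "norm a = 0"
      using norm_X_attained[of a] by (auto simp: zero_X.rep_eq)
  qed
  show "norm (a + b) \<le> norm a + norm b"
    by (rule norm_X_le) (metis plus_X.rep_eq norm_triangle_le add_mono norm_field_le)
  show "norm (r *\<^sub>R a) = \<bar>r\<bar> * norm a"
  proof (rule order_antisym)
    show "norm (r *\<^sub>R a) \<le> \<bar>r\<bar> * norm a"
      by (rule norm_X_le) (simp add: scaleR_X.rep_eq mult_left_mono norm_field_le)
    obtain x where "norm a = norm (field a x)" using norm_X_attained by blast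
    then have "\<bar>r\<bar> * norm a = norm (field (r *\<^sub>R a) x)" by (simp add: scaleR_X.rep_eq)
    then show "\<bar>r\<bar> * norm a \<le> norm (r *\<^sub>R a)" using norm_field_le by simp
  qed
qed

end

instance X :: (finite) banach
proof
  fix F :: "nat \<Rightarrow> 'a X"
  assume "Cauchy F"
  define G where "G n = field (F n)" for n
  have "uniformly_Cauchy_on UNIV G"
    unfolding uniformly_Cauchy_on_def
  proof (intro allI impI)
    fix e :: real assume "e > 0"
    then obtain M where M: "\<forall>m\<ge>M. \<forall>n\<ge>M. dist (F m) (F n) < e"
      using \<open>Cauchy F\<close> by (auto simp: Cauchy_def)
    have "dist (G m x) (G n x) \<le> dist (F m) (F n)" for m n x
      using norm_field_le[of "F m - F n" x]
      by (simp add: G_def dist_norm minus_X.rep_eq)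
    then show "\<exists>M. \<forall>x\<in>UNIV. \<forall>m\<ge>M. \<forall>n\<ge>M. dist (G m x) (G n x) < e"
      using M by (meson le_less_trans)
  qed
  then obtain g where g: "uniform_limit UNIV G g sequentially"
    using Cauchy_uniformly_convergent unfolding uniformly_convergent_on_def by blast
  have cont: "continuous_on UNIV g"
    by (rule uniform_limit_theorem[OF _ g]) (simp_all add: G_def continuous_field)
  have lim: "(\<lambda>n. G n x) \<longlonglongrightarrow> g x" for x
    using tendsto_uniform_limitI[OF g] by simp
  have "g (x + axis i 1) = g x" for x i
    using lim[of "x + axis i 1"] lim[of x] LIMSEQ_unique
    by (fastforce simp: G_def field_periodic)
  then have fg: "field (Abs_X g) = g" using cont by (simp add: Abs_X_inverse)
  have "F \<longlonglongrightarrow> Abs_X g"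
  proof (rule metric_LIMSEQ_I)
    fix e :: real assume "e > 0"
    then obtain M where M: "\<forall>n\<ge>M. \<forall>x. dist (G n x) (g x) < e / 2"
      using g by (auto simp: uniform_limit_sequentially_iff elim!: allE[of _ "e / 2"])
    have "dist (F n) (Abs_X g) < e" if "n \<ge> M" for n
    proof -
      have "norm (F n - Abs_X g) \<le> e / 2"
        by (rule norm_X_le)
           (use M that in \<open>auto simp: minus_X.rep_eq fg G_def dist_norm intro: less_imp_le\<close>)
      then show ?thesis using \<open>e > 0\<close> by (simp add: dist_norm)
    qed
    then show "\<exists>M. \<forall>n\<ge>M. dist (F n) (Abs_X g) < e" by blast
  qed
  then show "convergent F" by (auto simp: convergent_def)
qed

section \<open>Semigroups and their generators\<close>

definition C0_semigroup :: "(real \<Rightarrow> 'a::banach \<Rightarrow> 'a) \<Rightarrow> bool" where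
  "C0_semigroup S \<longleftrightarrow>
     (\<forall>t\<ge>0. bounded_linear (S t)) \<and>
     (\<forall>w. S 0 w = w) \<and>
     (\<forall>s\<ge>0. \<forall>t\<ge>0. \<forall>w. S (s + t) w = S s (S t w)) \<and>
     (\<forall>w. ((\<lambda>t. S t w) \<longlongrightarrow> w) (at_right 0))"

text \<open>Possibly unbounded operators are represented by their graphs.\<close>

definition generator :: "(real \<Rightarrow> 'a::banach \<Rightarrow> 'a) \<Rightarrow> ('a \<times> 'a) set" where
  "generator S = {(w, v). ((\<lambda>h. (S h w - w) /\<^sub>R h) \<longlongrightarrow> v) (at_right 0)}"

definition generates :: "('a::banach \<times> 'a) set \<Rightarrow> (real \<Rightarrow> 'a \<Rightarrow> 'a) \<Rightarrow> bool" where
  "generates A S \<longleftrightarrow> C0_semigroup S \<and> generator S = A"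

section \<open>The periodic Laplacian\<close>

definition has_partial :: "'m \<Rightarrow> 'm::finite X \<Rightarrow> 'm X \<Rightarrow> bool" where
  "has_partial i W V \<longleftrightarrow>
     (\<forall>x. ((\<lambda>h. field W (x + axis i h)) has_vector_derivative field V x) (at 0))"

text \<open>
  Since elements of \<open>'m X\<close> are continuous, the fields possessing all first and second order
  partial derivatives in \<open>'m X\<close> are exactly the periodic fields of class $C^2$.
\<close>

definition Laplacian_C2 :: "('m::finite X \<times> 'm X) set" where
  "Laplacian_C2 = {(W, V). \<exists>D H.
     (\<forall>i. has_partial i W (D i)) \<and>
     (\<forall>i j. has_partial j (D i) (H i j)) \<and>
     V = (\<Sum>i\<in>UNIV. H i i)}"

text \<open>
  The operator $\varepsilon^2\Delta$ with periodic boundary condition, as a closed operator on the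
  phase space. In dimension at least two the Laplacian on $C^2$ fields is not closed in the
  maximum norm, hence cannot itself be a generator; the closure of its graph is.
\<close>

definition L_op :: "real \<Rightarrow> ('m::finite X \<times> 'm X) set" where
  "L_op \<epsilon> = closure ((\<lambda>(W, V). (W, \<epsilon>\<^sup>2 *\<^sub>R V)) ` Laplacian_C2)"

section \<open>The equation and the scheme\<close>

lift_definition nonlin :: "real \<Rightarrow> 'm::finite X \<Rightarrow> 'm X" is
  "\<lambda>\<kappa> U x. \<kappa> *\<^sub>R U x + (U x - U x ** transpose (U x) ** U x)"
proof (intro CollectI conjI; (elim CollectE conjE)?)
  fix \<kappa> :: real and U :: "real ^ 'm \<Rightarrow> real ^ 'm ^ 'm"
  assume c: "continuous_on UNIV U" and "\<forall>x i. U (x + axis i 1) = U x"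
  then show "\<forall>x i. \<kappa> *\<^sub>R U (x + axis i 1) + (U (x + axis i 1)
      - U (x + axis i 1) ** transpose (U (x + axis i 1)) ** U (x + axis i 1))
    = \<kappa> *\<^sub>R U x + (U x - U x ** transpose (U x) ** U x)" by simp
  show "continuous_on UNIV (\<lambda>x. \<kappa> *\<^sub>R U x + (U x - U x ** transpose (U x) ** U x))"
    unfolding matrix_matrix_mult_def transpose_def
    by (intro continuous_intros continuous_on_vec_lambda c | simp)+
qed

text \<open>With \<open>S t\<close> standing for $e^{t\mathcal L}$, this is $e^{(\mathcal L-\kappa)t}$.\<close>

definition damped :: "(real \<Rightarrow> 'm::finite X \<Rightarrow> 'm X) \<Rightarrow> real \<Rightarrow> real \<Rightarrow> 'm X \<Rightarrow> 'm X" where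
  "damped S \<kappa> t W = exp (- \<kappa> * t) *\<^sub>R S t W"

definition exact_solution ::
  "(real \<Rightarrow> 'm::finite X \<Rightarrow> 'm X) \<Rightarrow> real \<Rightarrow> real \<Rightarrow> 'm X \<Rightarrow> (real \<Rightarrow> 'm X) \<Rightarrow> bool" where
  "exact_solution S \<kappa> T U0 U \<longleftrightarrow>
     continuous_on {0..T} U \<and>
     (\<forall>t\<in>{0..T}. norm (U t) \<le> sqrt (real CARD('m))) \<and>
     (\<forall>t\<in>{0..T}. U t = damped S \<kappa> t U0
        + integral {0..t} (\<lambda>s. damped S \<kappa> (t - s) (nonlin \<kappa> (U s))))"

primrec ETD1 ::
  "(real \<Rightarrow> 'm::finite X \<Rightarrow> 'm X) \<Rightarrow> real \<Rightarrow> real \<Rightarrow> 'm X \<Rightarrow> nat \<Rightarrow> 'm X" where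
  "ETD1 S \<kappa> \<tau> U0 0 = U0"
| "ETD1 S \<kappa> \<tau> U0 (Suc n) = damped S \<kappa> \<tau> (ETD1 S \<kappa> \<tau> U0 n)
     + integral {0..\<tau>} (\<lambda>s. damped S \<kappa> (\<tau> - s) (nonlin \<kappa> (ETD1 S \<kappa> \<tau> U0 n)))"

text \<open>Derivatives at the end points of \<open>{0..T}\<close> are one-sided.\<close>

definition C1_curve :: "real \<Rightarrow> (real \<Rightarrow> 'a::real_normed_vector) \<Rightarrow> bool" where
  "C1_curve T U \<longleftrightarrow>
     (\<forall>t\<in>{0..T}. U differentiable (at t within {0..T})) \<and>
     continuous_on {0..T} (\<lambda>t. vector_derivative U (at t within {0..T}))"

definition C1_norm :: "real \<Rightarrow> (real \<Rightarrow> 'a::real_normed_vector) \<Rightarrow> real" where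
  "C1_norm T U = (SUP t\<in>{0..T}. norm (U t))
     + (SUP t\<in>{0..T}. norm (vector_derivative U (at t within {0..T})))"

end

theory Submission
  imports Defs
begin

text \<open>
  Two facts carry the error estimate. The heat semigroup is a contraction in the maximum norm,
  and the nonlinearity maps the ball of radius \<open>sqrt m\<close> into the ball of radius
  \<open>\<kappa> * sqrt m\<close> and is Lipschitz there with constant \<open>\<kappa> + 1 + 3 * m\<close>.

  The semigroup is only known through its generator, the closure of $\varepsilon^2\Delta$ on
  $C^2$ fields. At a point \<open>x\<close> where the Frobenius norm of a $C^2$ field \<open>W\<close> is maximal, the scalar
  function \<open>\<lambda>y. field W x \<bullet> field W y\<close> has a maximum at \<open>x\<close>, so its Laplacian is nonpositive there; this
  makes the Laplacian dissipative, and dissipativity survives closure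
  (\<open>dissipative_L_op\<close>). A strongly continuous semigroup with dissipative generator is a
  contraction (\<open>dissipative_generator_imp_contraction\<close>), because the implicit Euler
  inequality \<open>norm w \<le> norm (w - h *\<^sub>R v)\<close> can be iterated along an orbit.

  The bound \<open>norm_nonlinearity_le\<close> on the nonlinearity is, in terms of the eigenvalues \<open>s\<close> of
  \<open>A ** transpose A\<close>, the statement that \<open>s * (\<kappa> + 1 - s)\<^sup>2\<close> lies below its tangent at \<open>s = 1\<close>
  for \<open>s \<le> 2 * \<kappa>\<close>; the tangent is nondecreasing and the eigenvalues sum to at most \<open>m\<close>. The bound
  implies that the iterates of the scheme stay in the ball of radius \<open>sqrt m\<close>
  (\<open>ETD1_norm_le\<close>), where the Lipschitz bound applies.

  Both the scheme and the exact solution, restarted at time \<open>n * \<tau>\<close>, are given by the same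
  variation of constants formula on a step of length \<open>\<tau>\<close>, one with frozen and one with moving
  argument of the nonlinearity. With \<open>L = 1 + 5 * m\<close> and \<open>C\<close> the $C^1$ norm of the solution, the
  difference of the arguments at time \<open>s\<close> into the step is at most \<open>norm e + C * s\<close>, where \<open>e\<close> is
  the error at the start of the step. The damping
  factor absorbs the \<open>\<kappa>\<close> in the Lipschitz constant exactly, because
  $e^{-\kappa\tau}+\int_0^\tau\kappa e^{-\kappa(\tau-s)}\,ds=1$. What remains is a growth factor
  \<open>1 + L * \<tau>\<close> and a consistency error \<open>(\<kappa> + L) * C * \<tau>\<^sup>2 / 2\<close> per step
  (\<open>ETD1_error_step\<close>), which a discrete Gronwall inequality sums up.
\<close>

section \<open>Strongly continuous semigroups with dissipative generator\<close>

text \<open>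
  The norm inequality says that implicit Euler steps for the operator with graph \<open>A\<close> do not
  increase the norm. It is equivalent to the definition of dissipativity by means of duality maps.
\<close>
definition dissipative :: "('a::real_normed_vector \<times> 'a) set \<Rightarrow> bool" where
  "dissipative A \<longleftrightarrow> (\<forall>(w, v)\<in>A. \<forall>h\<ge>0. norm w \<le> norm (w - h *\<^sub>R v))"

lemma right_difference_quotient:
  assumes "(F has_vector_derivative v) (at t within {t..b})" and "t < b"
  shows "((\<lambda>h. (F (t + h) - F t) /\<^sub>R h) \<longlongrightarrow> v) (at_right 0)"
proof -
  have "(F has_vector_derivative v) (at_right t)" using assms by (simp add: at_within_Icc_at_right)
  then have 1: "((\<lambda>y. (F y - (F t + (y - t) *\<^sub>R v)) /\<^sub>R norm (y - t)) \<longlongrightarrow> 0) (at_right t)"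
   unfolding has_vector_derivative_def has_derivative_within by (simp add: inverse_eq_divide)
  have "((\<lambda>h. (F (h + t) - (F t + h *\<^sub>R v)) /\<^sub>R \<bar>h\<bar>) \<longlongrightarrow> 0) (at_right 0)"
    using 1 unfolding at_right_to_0[of t] filterlim_filtermap by simp
  moreover have "\<forall>\<^sub>F h in at_right 0. (F (h + t) - (F t + h *\<^sub>R v)) /\<^sub>R \<bar>h\<bar>
      = (F (t + h) - F t) /\<^sub>R h - v"
    using eventually_at_right_less[of "0::real"]
  proof eventually_elim
    case (elim h)
    then show ?case
      by (simp add: scaleR_diff_right scaleR_add_right diff_diff_eq add.commute)
  qed
  ultimately have "((\<lambda>h. (F (t + h) - F t) /\<^sub>R h - v) \<longlongrightarrow> 0) (at_right 0)"
    by (rule Lim_transform_eventually)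
  then show ?thesis by (rule Lim_null[THEN iffD2])
qed

context
  fixes S :: "real \<Rightarrow> 'a::banach \<Rightarrow> 'a"
  assumes S: "C0_semigroup S"
begin

lemma semigroup_bounded_linear: "t \<ge> 0 \<Longrightarrow> bounded_linear (S t)"
  using S by (simp add: C0_semigroup_def)

lemma semigroup_zero: "S 0 w = w"
  using S by (simp add: C0_semigroup_def)

lemma semigroup_add: "s \<ge> 0 \<Longrightarrow> t \<ge> 0 \<Longrightarrow> S (s + t) w = S s (S t w)"
  using S by (simp add: C0_semigroup_def)

lemma semigroup_tendsto: "((\<lambda>t. S t w) \<longlongrightarrow> w) (at_right 0)"
  using S by (simp add: C0_semigroup_def)

text \<open>
  Every orbit is bounded near time zero by right continuity, with a bound and a time span that
  depend on the orbit. By the Baire category theorem one bound and one span serve all initial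
  values in some ball, and linearity spreads the bound to all of the space.
\<close>
lemma semigroup_bounded_near_zero:
  "\<exists>\<delta>>0. \<exists>M\<ge>1. \<forall>t\<in>{0..\<delta>}. \<forall>w. norm (S t w) \<le> M * norm w"
proof -
  \<comment> \<open>A single index controls both the bound and the time span, so countably many sets suffice.\<close>
  define E where "E n = {w. \<forall>t\<in>{0..1 / real (Suc n)}. norm (S t w) \<le> real n}" for n :: nat
  have closed_E: "closed (E n)" for n
  proof -
    have "E n = (\<Inter>t\<in>{0..1 / real (Suc n)}. {w. norm (S t w) \<le> real n})"
      by (auto simp: E_def)
    moreover have "closed {w. norm (S t w) \<le> real n}" if "t \<ge> 0" for t
    proof -
      interpret bounded_linear "S t" by (rule semigroup_bounded_linear[OF that])
      show ?thesis by (intro closed_Collect_le continuous_intros continuous_on)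
    qed
    ultimately show ?thesis by auto
  qed
  have cover: "\<exists>n. w \<in> E n" for w
  proof -
    have "\<forall>\<^sub>F t in at_right 0. dist (S t w) w < 1"
      using tendstoD[OF semigroup_tendsto, of 1] by simp
    then obtain b where b: "b > 0" "\<And>t. 0 < t \<Longrightarrow> t < b \<Longrightarrow> dist (S t w) w < 1"
      unfolding eventually_at_right_field by blast
    obtain n where n: "real n > max (1 / b) (norm w + 1)" using reals_Archimedean2 by blast
    have "norm (S t w) \<le> real n" if "t \<in> {0..1 / real (Suc n)}" for t
    proof (cases "t = 0")
      case True
      then show ?thesis using n by (simp add: semigroup_zero)
    next
      case False
      have "1 / real (Suc n) < b" using n b(1) by (simp add: field_simps)
      then have "dist (S t w) w < 1" using False that b(2)[of t] by auto
      then have "norm (S t w) < norm w + 1"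
        using norm_triangle_ineq2[of "S t w" w] by (simp add: dist_norm)
      then show ?thesis using n by simp
    qed
    then have "w \<in> E n" by (simp add: E_def)
    then show ?thesis ..
  qed
  have "\<exists>n. interior (E n) \<noteq> {}"
  proof (rule ccontr)
    assume "\<nexists>n. interior (E n) \<noteq> {}"
    then have "euclidean interior_of \<Union>(range E) = {}"
      by (intro Baire_category_alt) (auto simp: completely_metrizable_space_euclidean closed_E)
    moreover have "\<Union>(range E) = UNIV" using cover by auto
    ultimately show False by simp
  qed
  then obtain n c where "c \<in> interior (E n)" by auto
  then obtain r where r: "r > 0" "cball c r \<subseteq> E n"
    by (meson mem_interior_cball)
  have "norm (S t w) \<le> (2 * real n / r + 1) * norm w" if t: "t \<in> {0..1 / real (Suc n)}" for t w
  proof (cases "w = 0")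
    case True
    interpret bounded_linear "S t" using semigroup_bounded_linear t by simp
    show ?thesis using True by (simp add: zero)
  next
    case False
    interpret bounded_linear "S t" using semigroup_bounded_linear t by simp
    define a where "a = r / norm w"
    have a: "a > 0" using False r by (simp add: a_def)
    have "c + a *\<^sub>R w \<in> cball c r" "c \<in> cball c r"
      using r False by (auto simp: a_def dist_norm)
    then have "c + a *\<^sub>R w \<in> E n" "c \<in> E n"
      using r(2) by blast+
    then have "norm (S t (c + a *\<^sub>R w)) \<le> real n" "norm (S t c) \<le> real n"
      using t by (simp_all add: E_def)
    moreover have "S t (c + a *\<^sub>R w) = S t c + a *\<^sub>R S t w"
      by (simp add: add scaleR)
    ultimately have "norm (a *\<^sub>R S t w) \<le> 2 * real n"
      by (smt (verit) norm_triangle_ineq4 add_diff_cancel_left')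
    then have "norm (S t w) \<le> 2 * real n / a"
      using a by (simp add: field_simps)
    also have "\<dots> = 2 * real n / r * norm w" using r False by (simp add: a_def)
    also have "\<dots> \<le> (2 * real n / r + 1) * norm w" by (simp add: algebra_simps)
    finally show ?thesis .
  qed
  moreover have "1 / real (Suc n) > 0" "2 * real n / r + 1 \<ge> 1" using r by auto
  ultimately show ?thesis by blast
qed

lemma semigroup_locally_bounded:
  "\<exists>M\<ge>0. \<forall>t\<in>{0..b}. \<forall>w. norm (S t w) \<le> M * norm w"
proof -
  obtain \<delta> M where \<delta>: "\<delta> > 0" and M: "M \<ge> 1"
    and le: "\<And>t w. 0 \<le> t \<Longrightarrow> t \<le> \<delta> \<Longrightarrow> norm (S t w) \<le> M * norm w"
    using semigroup_bounded_near_zero by (metis atLeastAtMost_iff)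
  have pow: "norm (S t w) \<le> M ^ Suc n * norm w" if "0 \<le> t" "t \<le> real (Suc n) * \<delta>" for n t w
    using that
  proof (induction n arbitrary: t w)
    case 0
    then show ?case using le by simp
  next
    case (Suc n)
    define s where "s = min t \<delta>"
    have s: "0 \<le> s" "s \<le> \<delta>" "0 \<le> t - s" "t - s \<le> real (Suc n) * \<delta>"
      using Suc.prems \<delta> by (auto simp: s_def algebra_simps min_def)
    have "norm (S t w) = norm (S s (S (t - s) w))"
      using semigroup_add[of s "t - s" w] s by simp
    also have "\<dots> \<le> M * norm (S (t - s) w)" using le s by blast
    also have "\<dots> \<le> M * (M ^ Suc n * norm w)"
      by (rule mult_left_mono[OF Suc.IH]) (use s M in auto)
    finally show ?case by (simp add: mult.assoc)
  qed
  obtain n where "real n > b / \<delta>" using reals_Archimedean2 by blast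
  then have "b \<le> real (Suc n) * \<delta>" using \<delta> by (simp add: field_simps)
  moreover have "M ^ Suc n \<ge> 0" using M by simp
  ultimately show ?thesis using pow by (meson atLeastAtMost_iff order_trans)
qed

lemma semigroup_strongly_continuous: "continuous_on {0..} (\<lambda>t. S t w)"
proof (subst continuous_on_iff, intro ballI allI impI)
  fix t e :: real assume t: "t \<in> {0..}" and e: "e > 0"
  obtain M where M: "M \<ge> 0" "\<And>s w. 0 \<le> s \<Longrightarrow> s \<le> t + 1 \<Longrightarrow> norm (S s w) \<le> M * norm w"
    using semigroup_locally_bounded[of "t + 1"] by (metis atLeastAtMost_iff)
  have "\<forall>\<^sub>F h in at_right 0. dist (S h w) w < e / (M + 1)"
    using tendstoD[OF semigroup_tendsto, of "e / (M + 1)"] e M by simp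
  then obtain b where b: "b > 0" "\<And>h. 0 < h \<Longrightarrow> h < b \<Longrightarrow> dist (S h w) w < e / (M + 1)"
    unfolding eventually_at_right_field by blast
  have step: "dist (S r w) (S s w) < e" if "0 \<le> s" "s \<le> r" "s \<le> t + 1" "r - s < b" for r s
  proof (cases "s = r")
    case True
    then show ?thesis using e by simp
  next
    case False
    interpret bounded_linear "S s" using semigroup_bounded_linear that by simp
    have "dist (S r w) (S s w) = norm (S s (S (r - s) w - w))"
      using semigroup_add[of s "r - s" w] that by (simp add: dist_norm diff)
    also have "\<dots> \<le> M * norm (S (r - s) w - w)" using M that by simp
    also have "\<dots> \<le> M * (e / (M + 1))"
      by (rule mult_left_mono) (use b(2)[of "r - s"] False that M in \<open>auto simp: dist_norm\<close>)
    also have "\<dots> < e" using e M by (simp add: field_simps)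
    finally show ?thesis .
  qed
  show "\<exists>d>0. \<forall>s\<in>{0..}. dist s t < d \<longrightarrow> dist (S s w) (S t w) < e"
  proof (intro exI[of _ "min b 1"] conjI ballI impI)
    fix s assume "s \<in> {0..}" "dist s t < min b 1"
    then show "dist (S s w) (S t w) < e"
      using t step[of s t] step[of t s]
      by (cases "s \<le> t") (auto simp: dist_real_def dist_commute)
  qed (use b in simp)
qed

lemma generator_invariant:
  assumes "(w, v) \<in> generator S" and "t \<ge> 0"
  shows "(S t w, S t v) \<in> generator S"
proof -
  interpret bounded_linear "S t" using semigroup_bounded_linear assms by simp
  have "((\<lambda>h. S t ((S h w - w) /\<^sub>R h)) \<longlongrightarrow> S t v) (at_right 0)"
    using assms(1) by (intro tendsto) (simp add: generator_def)
  moreover have "\<forall>\<^sub>F h in at_right 0. S t ((S h w - w) /\<^sub>R h) = (S h (S t w) - S t w) /\<^sub>R h"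
    using eventually_at_right_less[of "0::real"]
  proof eventually_elim
    case (elim h)
    then have "S t (S h w) = S h (S t w)"
      using semigroup_add[of t h w] semigroup_add[of h t w] assms(2) by (simp add: add.commute)
    then show ?case by (simp add: scaleR diff)
  qed
  ultimately show ?thesis
    unfolding generator_def by (auto intro: Lim_transform_eventually)
qed

text \<open>
  Applying \<open>S h\<close> to the orbit integral shifts its interval of integration by \<open>h\<close>. The change is
  what is gained at the end \<open>b\<close> minus what is lost at the end \<open>0\<close>, and dividing by \<open>h\<close>
  leaves the endpoint values of the orbit.
\<close>
lemma orbit_integral_in_domain:
  assumes "b > 0"
  shows "(integral {0..b} (\<lambda>s. S s w), S b w - w) \<in> generator S"
proof -
  define F where "F t = integral {0..t} (\<lambda>s. S s w)" for t
  have cont: "continuous_on {c..d} (\<lambda>s. S s w)" if "c \<ge> 0" for c d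
    using semigroup_strongly_continuous by (rule continuous_on_subset) (use that in auto)
  have int: "(\<lambda>s. S s w) integrable_on {c..d}" if "c \<ge> 0" for c d
    using cont[OF that] by (rule integrable_continuous_interval)
  have quot: "((\<lambda>h. (F (t + h) - F t) /\<^sub>R h) \<longlongrightarrow> S t w) (at_right 0)" if "t \<ge> 0" for t
  proof (rule right_difference_quotient)
    show "(F has_vector_derivative S t w) (at t within {t..t + 1})"
      unfolding F_def using that
      by (intro has_vector_derivative_within_subset
          [OF integral_has_vector_derivative[OF cont[of 0 "t + 1"]]]) auto
  qed simp
  have "((\<lambda>h. (F (b + h) - F b) /\<^sub>R h - (F (0 + h) - F 0) /\<^sub>R h) \<longlongrightarrow> S b w - S 0 w) (at_right 0)"
    by (intro tendsto_diff quot) (use assms in auto)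
  moreover have "\<forall>\<^sub>F h in at_right 0. (F (b + h) - F b) /\<^sub>R h - (F (0 + h) - F 0) /\<^sub>R h
      = (S h (F b) - F b) /\<^sub>R h"
    using eventually_at_right_less[of "0::real"]
  proof eventually_elim
    case (elim h)
    have "S h (F b) = integral {0..b} (S h \<circ> (\<lambda>s. S s w))"
      unfolding F_def
      by (rule integral_linear[symmetric]) (use elim int semigroup_bounded_linear in auto)
    also have "\<dots> = integral {0..b} ((\<lambda>s. S s w) \<circ> (+) h)"
      by (rule integral_cong) (use elim in \<open>simp add: semigroup_add\<close>)
    also have "\<dots> = integral {h..b + h} (\<lambda>s. S s w)"
      by (simp add: integral_shift_Icc_real)
    also have "\<dots> = F (b + h) - F h"
      using Henstock_Kurzweil_Integration.integral_combine[of 0 h "b + h" "\<lambda>s. S s w"] int elim assms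
      by (simp add: F_def algebra_simps)
    finally have "S h (F b) - F b = (F (b + h) - F b) - (F (0 + h) - F 0)"
      by (simp add: F_def)
    then show ?case by (simp only: scaleR_diff_right)
  qed
  ultimately have "((\<lambda>h. (S h (F b) - F b) /\<^sub>R h) \<longlongrightarrow> S b w - S 0 w) (at_right 0)"
    by (rule Lim_transform_eventually)
  then show ?thesis by (simp add: generator_def F_def semigroup_zero)
qed

lemma generator_scaleR:
  assumes "(w, v) \<in> generator S"
  shows "(c *\<^sub>R w, c *\<^sub>R v) \<in> generator S"
proof -
  have "((\<lambda>h. c *\<^sub>R ((S h w - w) /\<^sub>R h)) \<longlongrightarrow> c *\<^sub>R v) (at_right 0)"
    using assms by (intro tendsto_intros) (simp add: generator_def)
  moreover have "\<forall>\<^sub>F h in at_right 0.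
      c *\<^sub>R ((S h w - w) /\<^sub>R h) = (S h (c *\<^sub>R w) - c *\<^sub>R w) /\<^sub>R h"
    using eventually_at_right_less[of "0::real"]
  proof eventually_elim
    case (elim h)
    interpret bounded_linear "S h" using semigroup_bounded_linear elim by simp
    show ?case by (simp add: scaleR scaleR_diff_right mult.commute)
  qed
  ultimately show ?thesis unfolding generator_def by (auto intro: Lim_transform_eventually)
qed

text \<open>
  A vector is the limit of the averages of its orbit over short time intervals, and these
  averages lie in the domain.
\<close>
lemma generator_domain_dense: "closure (Domain (generator S)) = UNIV"
proof -
  have "w \<in> closure (Domain (generator S))" for w
  proof (rule Lim_in_closed_set[OF closed_closure])
    have "continuous_on {0..1} (\<lambda>s. S s w)"
      using semigroup_strongly_continuous by (rule continuous_on_subset) auto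
    then have "((\<lambda>t. integral {0..t} (\<lambda>s. S s w)) has_vector_derivative S 0 w) (at 0 within {0..1})"
      by (rule integral_has_vector_derivative) simp
    from right_difference_quotient[OF this]
    show "((\<lambda>h. integral {0..h} (\<lambda>s. S s w) /\<^sub>R h) \<longlongrightarrow> w) (at_right 0)"
      by (simp add: semigroup_zero)
    show "\<forall>\<^sub>F h in at_right 0.
        integral {0..h} (\<lambda>s. S s w) /\<^sub>R h \<in> closure (Domain (generator S))"
      using eventually_at_right_less[of "0::real"]
      by eventually_elim
        (metis orbit_integral_in_domain generator_scaleR DomainI closure_subset subsetD)
  qed simp
  then show ?thesis by blast
qed

text \<open>
  Let \<open>w\<close> be in the domain, with image \<open>v\<close>. Dissipativity at the point \<open>S (s + h) w\<close> of the
  orbit bounds its norm by that of \<open>S (s + h) w - h *\<^sub>R S (s + h) v\<close>, which differs from \<open>S s w\<close> by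
  \<open>S s\<close> applied to a remainder that is independent of \<open>s\<close> and of order $o(h)$. Dividing the time
  interval into \<open>N\<close> equal steps accumulates only $N\,o(t/N)$, which tends to zero. Local
  boundedness of the semigroup makes these remainders uniform, and density of the domain extends
  the inequality to all vectors.
\<close>
lemma dissipative_generator_imp_contraction:
  assumes diss: "dissipative (generator S)" and t: "t \<ge> 0"
  shows "norm (S t w) \<le> norm w"
proof -
  obtain M where M: "M \<ge> 0" "\<And>s w. 0 \<le> s \<Longrightarrow> s \<le> t \<Longrightarrow> norm (S s w) \<le> M * norm w"
    using semigroup_locally_bounded[of t] by (metis atLeastAtMost_iff)
  have dom: "norm (S t w) \<le> norm w" if wv: "(w, v) \<in> generator S" and t0: "t > 0" for w v
  proof -
    define r where "r h = norm (S h w - w - h *\<^sub>R S h v)" for h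
    have step: "norm (S (s + h) w) \<le> norm (S s w) + M * r h"
      if s: "0 \<le> s" "s \<le> t" and h: "0 \<le> h" for s h
    proof -
      interpret bounded_linear "S s" using semigroup_bounded_linear s by simp
      have "(S (s + h) w, S (s + h) v) \<in> generator S"
        using generator_invariant[OF wv] s h by simp
      then have "norm (S (s + h) w) \<le> norm (S (s + h) w - h *\<^sub>R S (s + h) v)"
        using diss h by (auto simp: dissipative_def)
      also have "S (s + h) w - h *\<^sub>R S (s + h) v = S s w + S s (S h w - w - h *\<^sub>R S h v)"
        using s h by (simp add: semigroup_add diff scaleR)
      also have "norm \<dots> \<le> norm (S s w) + M * r h"
        using M(2)[of s] s by (intro norm_triangle_le add_left_mono) (simp add: r_def)
      finally show ?thesis .
    qed
    have chain: "norm (S (real k * h) w) \<le> norm w + real k * (M * r h)"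
      if "0 \<le> h" "real k * h \<le> t" for k h
      using that
    proof (induction k)
      case 0
      then show ?case by (simp add: semigroup_zero)
    next
      case (Suc k)
      have k: "real k * h \<le> t" using Suc.prems by (simp add: algebra_simps)
      have "norm (S (real k * h + h) w) \<le> norm (S (real k * h) w) + M * r h"
        by (rule step) (use Suc.prems k in auto)
      then show ?case using Suc.IH[OF Suc.prems(1) k] by (simp add: algebra_simps)
    qed
    have "((\<lambda>h. norm ((S h w - w) /\<^sub>R h - S h v)) \<longlongrightarrow> norm (v - v)) (at_right 0)"
      using wv semigroup_tendsto by (intro tendsto_intros) (auto simp: generator_def)
    moreover have "\<forall>\<^sub>F h in at_right 0. norm ((S h w - w) /\<^sub>R h - S h v) = r h / h"
      using eventually_at_right_less[of "0::real"]
    proof eventually_elim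
      case (elim h)
      have "(S h w - w) /\<^sub>R h - S h v = (S h w - w - h *\<^sub>R S h v) /\<^sub>R h"
        using elim by (simp add: scaleR_diff_right)
      then show ?case using elim by (simp add: r_def divide_inverse mult.commute)
    qed
    ultimately have "((\<lambda>h. r h / h) \<longlongrightarrow> 0) (at_right 0)"
      using Lim_transform_eventually by fastforce
    moreover have "filterlim (\<lambda>n. t / real (Suc n)) (at_right 0) sequentially"
      unfolding filterlim_at
      using t0 LIMSEQ_Suc[OF lim_const_over_n[of t]] by (auto intro!: always_eventually)
    ultimately have "(\<lambda>n. r (t / real (Suc n)) / (t / real (Suc n))) \<longlonglongrightarrow> 0"
      by (rule filterlim_compose)
    then have "(\<lambda>n. norm w + t * M * (r (t / real (Suc n)) / (t / real (Suc n)))) \<longlonglongrightarrow>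
        norm w + t * M * 0"
      by (intro tendsto_intros)
    moreover have "norm (S t w) \<le> norm w + t * M * (r (t / real (Suc n)) / (t / real (Suc n)))" for n
    proof -
      have "real (Suc n) * (t / real (Suc n)) = t" by simp
      moreover have "t * M * (r (t / real (Suc n)) / (t / real (Suc n)))
          = real (Suc n) * (M * r (t / real (Suc n)))"
        using t0 by (simp add: divide_simps)
      moreover have "t / real (Suc n) \<ge> 0" using t0 by simp
      ultimately show ?thesis using chain[of "t / real (Suc n)" "Suc n"] by (simp only: order_refl)
    qed
    ultimately show ?thesis by (intro LIMSEQ_le_const) auto
  qed
  show ?thesis
  proof (cases "t = 0")
    case True
    then show ?thesis by (simp add: semigroup_zero)
  next
    case False
    interpret bounded_linear "S t" using semigroup_bounded_linear t by simp
    have "closed {w. norm (S t w) \<le> norm w}"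
      by (intro closed_Collect_le continuous_intros continuous_on)
    moreover have "Domain (generator S) \<subseteq> {w. norm (S t w) \<le> norm w}"
      using dom False t by auto
    ultimately have "closure (Domain (generator S)) \<subseteq> {w. norm (S t w) \<le> norm w}"
      by (rule closure_minimal[rotated])
    then show ?thesis using generator_domain_dense by auto
  qed
qed

end

section \<open>Dissipativity of the periodic Laplacian\<close>

lemma second_derivative_nonpos_at_max:
  fixes \<phi> :: "real \<Rightarrow> real"
  assumes "\<And>h. (\<phi> has_real_derivative \<phi>' h) (at h)"
    and "(\<phi>' has_real_derivative d) (at a)"
    and max: "\<And>h. \<phi> h \<le> \<phi> a"
  shows "d \<le> 0"
proof (rule ccontr)
  assume "\<not> d \<le> 0"
  have "\<phi>' a = 0"
    by (rule DERIV_local_max[OF assms(1), of 1]) (use max in auto)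
  with \<open>\<not> d \<le> 0\<close> obtain b where b: "b > 0" "\<And>h. 0 < h \<Longrightarrow> h < b \<Longrightarrow> 0 < \<phi>' (a + h)"
    using DERIV_pos_inc_right[OF assms(2)] by auto
  have "\<exists>z. a < z \<and> z < a + b / 2 \<and> \<phi> (a + b / 2) - \<phi> a = (a + b / 2 - a) * \<phi>' z"
    by (rule MVT2) (use b assms(1) in auto)
  then obtain z where z: "a < z" "z < a + b / 2" "\<phi> (a + b / 2) - \<phi> a = b / 2 * \<phi>' z"
    by auto
  have "0 < \<phi>' (a + (z - a))" by (rule b(2)) (use z b(1) in auto)
  then have "0 < b / 2 * \<phi>' z" using b(1) by simp
  then show False using max[of "a + b / 2"] z(3) by linarith
qed

text \<open>
  The definition of partial derivatives differentiates at parameter \<open>0\<close> of a line through every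
  point; shifting the base point gives the derivative at every parameter of one line.
\<close>
lemma has_partial_inner:
  assumes "has_partial i W V"
  shows "((\<lambda>h. A \<bullet> field W (x + axis i h)) has_real_derivative A \<bullet> field V (x + axis i h)) (at h)"
proof -
  have "((\<lambda>k. field W ((x + axis i h) + axis i k)) has_vector_derivative field V (x + axis i h)) (at 0)"
    using assms by (simp add: has_partial_def)
  moreover have "(x + axis i h) + axis i k = x + axis i (k + h)" for k
    by (simp add: vec_eq_iff axis_def)
  ultimately have "((\<lambda>k. field W (x + axis i (k + h))) has_vector_derivative field V (x + axis i h)) (at 0)"
    by simp
  then have "((\<lambda>k. A \<bullet> field W (x + axis i (k + h))) has_vector_derivative A \<bullet> field V (x + axis i h)) (at 0)"
    by (rule bounded_linear.has_vector_derivative[OF bounded_linear_inner_right])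
  then show ?thesis
    using DERIV_shift[of "\<lambda>h. A \<bullet> field W (x + axis i h)" _ 0 h]
    by (simp add: has_real_derivative_iff_has_vector_derivative)
qed

text \<open>
  At a point \<open>x\<close> where the norm of \<open>W\<close> is attained, the Cauchy--Schwarz inequality shows that
  \<open>A \<bullet> field W y\<close> with \<open>A = field W x\<close> is maximal at \<open>y = x\<close>. Hence \<open>A \<bullet> field V x \<le> 0\<close> for the
  Laplacian \<open>V\<close> of \<open>W\<close>, and the component of \<open>W - h *\<^sub>R V\<close> along \<open>A\<close> at \<open>x\<close> cannot be
  smaller than that of \<open>W\<close>.
\<close>
lemma dissipative_Laplacian_C2: "dissipative (Laplacian_C2 :: ('m::finite X \<times> 'm X) set)"
  unfolding dissipative_def
proof (clarify)
  fix W V :: "'m X" and h :: real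
  assume WV: "(W, V) \<in> Laplacian_C2" and h: "h \<ge> 0"
  obtain D H where D: "\<And>i. has_partial i W (D i)" and H: "\<And>i j. has_partial j (D i) (H i j)"
    and V: "V = (\<Sum>i\<in>UNIV. H i i)"
    using WV by (auto simp: Laplacian_C2_def)
  obtain x where x: "norm W = norm (field W x)" using norm_X_attained by blast
  define A where "A = field W x"
  have max: "A \<bullet> field W y \<le> A \<bullet> A" for y
  proof -
    have "A \<bullet> field W y \<le> norm A * norm (field W y)" by (rule norm_cauchy_schwarz)
    also have "\<dots> \<le> norm A * norm A"
      using norm_field_le[of W y] x by (intro mult_left_mono) (auto simp: A_def)
    finally show ?thesis by (simp add: power2_norm_eq_inner[symmetric] power2_eq_square)
  qed
  have "A \<bullet> field (H i i) x \<le> 0" for i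
  proof (rule second_derivative_nonpos_at_max)
    show "((\<lambda>h. A \<bullet> field W (x + axis i h)) has_real_derivative A \<bullet> field (D i) (x + axis i h)) (at h)" for h
      using D by (rule has_partial_inner)
    have x0: "x + axis i 0 = x" by (simp add: vec_eq_iff axis_def)
    show "((\<lambda>h. A \<bullet> field (D i) (x + axis i h)) has_real_derivative A \<bullet> field (H i i) x) (at 0)"
      using has_partial_inner[OF H[of i i], where h=0 and x=x and A=A] unfolding x0 .
    show "A \<bullet> field W (x + axis i h) \<le> A \<bullet> field W (x + axis i 0)" for h
      using max unfolding x0 A_def .
  qed
  moreover have "field (\<Sum>i\<in>I. H i i) x = (\<Sum>i\<in>I. field (H i i) x)" if "finite I" for I
    using that by induction (simp_all add: zero_X.rep_eq plus_X.rep_eq)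
  ultimately have "A \<bullet> field V x \<le> 0"
    by (simp add: V inner_sum_right sum_nonpos)
  then have "A \<bullet> A \<le> A \<bullet> (A - h *\<^sub>R field V x)"
    using h by (simp add: inner_diff_right mult_nonneg_nonpos)
  also have "\<dots> \<le> norm A * norm (A - h *\<^sub>R field V x)" by (rule norm_cauchy_schwarz)
  also have "A - h *\<^sub>R field V x = field (W - h *\<^sub>R V) x"
    by (simp add: A_def minus_X.rep_eq scaleR_X.rep_eq)
  also have "norm A * norm (field (W - h *\<^sub>R V) x) \<le> norm A * norm (W - h *\<^sub>R V)"
    by (intro mult_left_mono norm_field_le) simp
  finally have "norm A * norm A \<le> norm A * norm (W - h *\<^sub>R V)"
    by (simp add: power2_norm_eq_inner[symmetric] power2_eq_square)
  then show "norm W \<le> norm (W - h *\<^sub>R V)"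
    by (cases "norm A = 0") (auto simp: x A_def[symmetric])
qed

lemma dissipative_scaleR:
  assumes "dissipative A" and "c \<ge> 0"
  shows "dissipative ((\<lambda>(w, v). (w, c *\<^sub>R v)) ` A)"
  unfolding dissipative_def
proof (clarify)
  fix w v and h :: real
  assume "(w, v) \<in> A" "h \<ge> 0"
  moreover from this have "h * c \<ge> 0" using assms(2) by simp
  ultimately show "norm w \<le> norm (w - h *\<^sub>R c *\<^sub>R v)"
    using assms(1) by (auto simp: dissipative_def)
qed

lemma dissipative_closure:
  assumes "dissipative A"
  shows "dissipative (closure A)"
proof -
  have "closure A \<subseteq> {p. norm (fst p) \<le> norm (fst p - h *\<^sub>R snd p)}" if "h \<ge> 0" for h
  proof (rule closure_minimal)
    show "A \<subseteq> {p. norm (fst p) \<le> norm (fst p - h *\<^sub>R snd p)}"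
      using assms that by (auto simp: dissipative_def)
    show "closed {p. norm (fst p) \<le> norm (fst p - h *\<^sub>R snd p)}"
      by (intro closed_Collect_le continuous_intros)
  qed
  then show ?thesis by (fastforce simp: dissipative_def)
qed

lemma dissipative_L_op: "dissipative (L_op \<epsilon>)"
  unfolding L_op_def
  by (intro dissipative_closure dissipative_scaleR dissipative_Laplacian_C2) simp

section \<open>The nonlinearity in the Frobenius norm\<close>

lemma inner_matrix: "A \<bullet> B = (\<Sum>i\<in>UNIV. \<Sum>j\<in>UNIV. A $ i $ j * B $ i $ j)"
  for A B :: "real ^ 'n ^ 'k"
  by (simp add: inner_vec_def)

lemma matrix_diff_ldistrib: "A ** (B - C) = A ** B - A ** C"
  for A :: "real ^ 'l ^ 'k" and B C :: "real ^ 'n ^ 'l"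
  by (simp add: vec_eq_iff matrix_matrix_mult_def right_diff_distrib sum_subtractf)

lemma matrix_diff_rdistrib: "(A - B) ** C = A ** C - B ** C"
  for A B :: "real ^ 'l ^ 'k" and C :: "real ^ 'n ^ 'l"
  by (simp add: vec_eq_iff matrix_matrix_mult_def left_diff_distrib sum_subtractf)

lemma transpose_diff: "transpose (A - B) = transpose A - transpose B"
  for A B :: "real ^ 'n ^ 'k"
  by (simp add: vec_eq_iff transpose_def)

lemma inner_transpose: "transpose A \<bullet> transpose B = A \<bullet> B" for A B :: "real ^ 'n ^ 'k"
  unfolding inner_matrix by (subst sum.swap) (simp add: transpose_def)

lemma norm_transpose: "norm (transpose A) = norm A" for A :: "real ^ 'n ^ 'k"
  by (simp add: norm_eq_sqrt_inner inner_transpose)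

lemma inner_matrix_mult_left:
  fixes A :: "real ^ 'n ^ 'k" and B :: "real ^ 'l ^ 'k" and C :: "real ^ 'n ^ 'l"
  shows "A \<bullet> (B ** C) = (transpose B ** A) \<bullet> C"
proof -
  have "A \<bullet> (B ** C) = (\<Sum>i\<in>UNIV. \<Sum>j\<in>UNIV. \<Sum>k\<in>UNIV. B $ i $ k * A $ i $ j * C $ k $ j)"
    by (simp add: inner_matrix matrix_matrix_mult_def sum_distrib_left mult_ac)
  also have "\<dots> = (\<Sum>i\<in>UNIV. \<Sum>k\<in>UNIV. \<Sum>j\<in>UNIV. B $ i $ k * A $ i $ j * C $ k $ j)"
    by (intro sum.cong refl sum.swap)
  also have "\<dots> = (\<Sum>k\<in>UNIV. \<Sum>i\<in>UNIV. \<Sum>j\<in>UNIV. B $ i $ k * A $ i $ j * C $ k $ j)"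
    by (rule sum.swap)
  also have "\<dots> = (\<Sum>k\<in>UNIV. \<Sum>j\<in>UNIV. \<Sum>i\<in>UNIV. B $ i $ k * A $ i $ j * C $ k $ j)"
    by (intro sum.cong refl sum.swap)
  also have "\<dots> = (transpose B ** A) \<bullet> C"
    by (simp add: inner_matrix matrix_matrix_mult_def transpose_def sum_distrib_right)
  finally show ?thesis .
qed

lemma inner_matrix_mult_right:
  fixes A :: "real ^ 'n ^ 'k" and B :: "real ^ 'l ^ 'k" and C :: "real ^ 'n ^ 'l"
  shows "A \<bullet> (B ** C) = (A ** transpose C) \<bullet> B"
proof -
  have "A \<bullet> (B ** C) = transpose A \<bullet> (transpose C ** transpose B)"
    by (metis inner_transpose matrix_transpose_mul)
  also have "\<dots> = (C ** transpose A) \<bullet> transpose B"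
    by (simp add: inner_matrix_mult_left)
  also have "\<dots> = (A ** transpose C) \<bullet> B"
    by (metis inner_transpose matrix_transpose_mul transpose_transpose)
  finally show ?thesis .
qed

lemma norm_matrix_mult_le:
  fixes A :: "real ^ 'l ^ 'k" and B :: "real ^ 'n ^ 'l"
  shows "norm (A ** B) \<le> norm A * norm B"
proof -
  have sq: "(norm M)\<^sup>2 = (\<Sum>i\<in>UNIV. (norm (M $ i))\<^sup>2)" for M :: "real ^ 'a ^ 'b"
    by (simp add: norm_vec_def[of M] L2_set_def sum_nonneg)
  have "(norm (A ** B))\<^sup>2 = (\<Sum>i\<in>UNIV. \<Sum>j\<in>UNIV. ((A $ i) \<bullet> (transpose B $ j))\<^sup>2)"
    unfolding power2_norm_eq_inner inner_matrix
    by (simp add: matrix_matrix_mult_def inner_vec_def transpose_def power2_eq_square)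
  also have "\<dots> \<le> (\<Sum>i\<in>UNIV. \<Sum>j\<in>UNIV. (norm (A $ i))\<^sup>2 * (norm (transpose B $ j))\<^sup>2)"
    by (intro sum_mono) (metis Cauchy_Schwarz_ineq power2_norm_eq_inner)
  also have "\<dots> = (norm A)\<^sup>2 * (norm (transpose B))\<^sup>2"
    by (simp add: sq sum_product)
  also have "\<dots> = (norm A * norm B)\<^sup>2" by (simp add: norm_transpose power_mult_distrib)
  finally show ?thesis by (rule power2_le_imp_le) simp
qed

lemma norm_mat_1: "(norm (mat 1 :: real ^ 'n ^ 'n))\<^sup>2 = real CARD('n)"
proof -
  have "(\<Sum>j\<in>UNIV. (mat 1 :: real ^ 'n ^ 'n) $ i $ j * (mat 1 :: real ^ 'n ^ 'n) $ i $ j) = 1" for i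
  proof -
    have "(\<Sum>j\<in>UNIV. (mat 1 :: real ^ 'n ^ 'n) $ i $ j * (mat 1 :: real ^ 'n ^ 'n) $ i $ j)
        = (\<Sum>j\<in>UNIV. if i = j then 1 else 0)"
      by (rule sum.cong) (simp_all add: mat_def)
    then show ?thesis by simp
  qed
  then show ?thesis by (simp add: power2_norm_eq_inner inner_matrix)
qed

lemma norm_cubic_diff_le:
  fixes A B :: "real ^ 'n ^ 'k"
  assumes A: "norm A \<le> r" and B: "norm B \<le> r"
  shows "norm (A ** transpose A ** A - B ** transpose B ** B) \<le> 3 * r\<^sup>2 * norm (A - B)"
proof -
  have r: "r \<ge> 0" using A norm_ge_zero order_trans by blast
  have tri: "norm (P ** transpose Q ** R) \<le> norm P * norm Q * norm R" for P Q R :: "real ^ 'n ^ 'k"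
  proof -
    have "norm (P ** transpose Q ** R) \<le> norm (P ** transpose Q) * norm R"
      by (rule norm_matrix_mult_le)
    also have "\<dots> \<le> norm P * norm (transpose Q) * norm R"
      by (intro mult_right_mono norm_matrix_mult_le) simp
    finally show ?thesis by (simp add: norm_transpose)
  qed
  have "A ** transpose A ** A - B ** transpose B ** B
      = (A - B) ** transpose A ** A + B ** transpose (A - B) ** A + B ** transpose B ** (A - B)"
    by (simp add: matrix_diff_ldistrib matrix_diff_rdistrib transpose_diff)
  also have "norm \<dots> \<le> norm (A - B) * norm A * norm A + norm B * norm (A - B) * norm A
      + norm B * norm B * norm (A - B)"
    by (intro norm_triangle_mono tri)
  also have "\<dots> \<le> norm (A - B) * r * r + r * norm (A - B) * r + r * r * norm (A - B)"
    using A B r by (intro add_mono mult_mono) auto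
  finally show ?thesis by (simp add: power2_eq_square algebra_simps)
qed

text \<open>
  For the eigenvalues \<open>s\<close> of \<open>A ** transpose A\<close> this is the sum of the scalar identities
  $s(\kappa+1-s)^2=\kappa^2+\kappa(\kappa-2)(s-1)-(2\kappa-s)(s-1)^2$, whose right-hand side splits
  off the tangent at \<open>s = 1\<close>. Since all the terms are traces of polynomials in \<open>A ** transpose A\<close>, the
  identity can be checked with Frobenius inner products, without diagonalizing.
\<close>
lemma norm_nonlinearity_identity:
  fixes A :: "real ^ 'n ^ 'n"
  defines "Q \<equiv> A ** transpose A - mat 1"
  shows "(norm (\<kappa> *\<^sub>R A + (A - A ** transpose A ** A)))\<^sup>2
    = \<kappa>\<^sup>2 * real CARD('n) + \<kappa> * (\<kappa> - 2) * ((norm A)\<^sup>2 - real CARD('n))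
      - (2 * \<kappa> * (norm Q)\<^sup>2 - (norm (transpose A ** Q))\<^sup>2)"
proof -
  define P where "P = A ** transpose A"
  have tP: "transpose P = P" by (simp add: P_def matrix_transpose_mul transpose_transpose)
  \<comment> \<open>The squared norms of \<open>A\<close>, \<open>P\<close> and \<open>P ** A\<close> are the traces of the first three powers
    of \<open>P\<close>; all the terms are linear combinations of them and the dimension.\<close>
  define b where "b = (norm P)\<^sup>2"
  have AP: "A \<bullet> (P ** A) = b"
    by (simp add: inner_matrix_mult_right b_def power2_norm_eq_inner) (simp add: P_def)
  have P1: "P \<bullet> mat 1 = (norm A)\<^sup>2"
    using inner_matrix_mult_right[of "mat 1" A "transpose A"]
    by (simp add: P_def inner_commute transpose_transpose power2_norm_eq_inner)
  have tAP: "transpose A \<bullet> (transpose A ** P) = b"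
    by (simp add: inner_matrix_mult_left transpose_transpose b_def power2_norm_eq_inner)
       (simp add: P_def)
  have c: "norm (transpose A ** P) = norm (P ** A)"
    by (metis norm_transpose matrix_transpose_mul tP transpose_transpose)
  have "(norm (\<kappa> *\<^sub>R A + (A - P ** A)))\<^sup>2 = (norm ((\<kappa> + 1) *\<^sub>R A - P ** A))\<^sup>2"
    by (simp add: algebra_simps)
  also have "\<dots> = (\<kappa> + 1)\<^sup>2 * (norm A)\<^sup>2 - 2 * (\<kappa> + 1) * b + (norm (P ** A))\<^sup>2"
    using AP unfolding power2_norm_eq_inner
    by (simp add: inner_diff_left inner_diff_right inner_commute power2_eq_square algebra_simps)
  finally have lhs: "(norm (\<kappa> *\<^sub>R A + (A - P ** A)))\<^sup>2
      = (\<kappa> + 1)\<^sup>2 * (norm A)\<^sup>2 - 2 * (\<kappa> + 1) * b + (norm (P ** A))\<^sup>2" .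
  have Q: "(norm Q)\<^sup>2 = b - 2 * (norm A)\<^sup>2 + real CARD('n)"
    using P1 norm_mat_1[where 'n='n]
    by (simp add: Q_def P_def[symmetric] b_def power2_norm_eq_inner inner_diff_left
        inner_diff_right inner_commute)
  have "transpose A ** Q = transpose A ** P - transpose A"
    by (simp add: Q_def P_def[symmetric] matrix_diff_ldistrib)
  then have "(norm (transpose A ** Q))\<^sup>2 = (norm (transpose A ** P))\<^sup>2 - 2 * b + (norm (transpose A))\<^sup>2"
    using tAP by (simp add: power2_norm_eq_inner inner_diff_left inner_diff_right inner_commute)
  then have AQ: "(norm (transpose A ** Q))\<^sup>2 = (norm (P ** A))\<^sup>2 - 2 * b + (norm A)\<^sup>2"
    by (simp add: c norm_transpose)
  show ?thesis
    unfolding P_def[symmetric] lhs Q AQ by (simp add: power2_eq_square algebra_simps)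
qed

text \<open>
  In the identity above, the tangent is at most its value for \<open>(norm A)\<^sup>2 = CARD('n)\<close>, as its slope
  \<open>\<kappa> * (\<kappa> - 2)\<close> is nonnegative. The subtracted remainder is nonnegative because the Frobenius norm is
  submultiplicative and \<open>(norm A)\<^sup>2 \<le> 2 * \<kappa>\<close>.
\<close>
lemma norm_nonlinearity_le:
  fixes A :: "real ^ 'n ^ 'n"
  assumes "\<kappa> \<ge> 2" and "real CARD('n) \<le> 2 * \<kappa>" and "norm A \<le> sqrt (real CARD('n))"
  shows "norm (\<kappa> *\<^sub>R A + (A - A ** transpose A ** A)) \<le> \<kappa> * sqrt (real CARD('n))"
proof -
  define Q where "Q = A ** transpose A - mat 1"
  have A: "(norm A)\<^sup>2 \<le> real CARD('n)"
    using assms(3) by (metis norm_ge_zero of_nat_0_le_iff power_mono real_sqrt_pow2)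
  have "(norm (transpose A ** Q))\<^sup>2 \<le> (norm A)\<^sup>2 * (norm Q)\<^sup>2"
    using norm_matrix_mult_le[of "transpose A" Q]
    by (metis norm_ge_zero norm_transpose power_mono power_mult_distrib)
  also have "\<dots> \<le> 2 * \<kappa> * (norm Q)\<^sup>2"
    using A assms(2) by (intro mult_right_mono) auto
  finally have "2 * \<kappa> * (norm Q)\<^sup>2 - (norm (transpose A ** Q))\<^sup>2 \<ge> 0" by simp
  moreover have "\<kappa> * (\<kappa> - 2) * ((norm A)\<^sup>2 - real CARD('n)) \<le> 0"
    using A assms(1) by (intro mult_nonneg_nonpos) auto
  ultimately have "(norm (\<kappa> *\<^sub>R A + (A - A ** transpose A ** A)))\<^sup>2 \<le> \<kappa>\<^sup>2 * real CARD('n)"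
    unfolding norm_nonlinearity_identity Q_def[symmetric] by linarith
  also have "\<dots> = (\<kappa> * sqrt (real CARD('n)))\<^sup>2" by (simp add: power_mult_distrib)
  finally show ?thesis by (rule power2_le_imp_le) (use assms in simp)
qed

lemma norm_nonlin_le:
  fixes W :: "'m::finite X"
  assumes "\<kappa> \<ge> 2" and "real CARD('m) \<le> 2 * \<kappa>" and "norm W \<le> sqrt (real CARD('m))"
  shows "norm (nonlin \<kappa> W) \<le> \<kappa> * sqrt (real CARD('m))"
proof (rule norm_X_le)
  fix x
  have "norm (field W x) \<le> sqrt (real CARD('m))"
    using norm_field_le[of W x] assms(3) by linarith
  then show "norm (field (nonlin \<kappa> W) x) \<le> \<kappa> * sqrt (real CARD('m))"
    unfolding nonlin.rep_eq by (intro norm_nonlinearity_le assms(1,2))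
qed

lemma nonlin_lipschitz:
  fixes V W :: "'m::finite X"
  assumes "\<kappa> \<ge> 0" and "norm V \<le> r" and "norm W \<le> r"
  shows "norm (nonlin \<kappa> V - nonlin \<kappa> W) \<le> (\<kappa> + 1 + 3 * r\<^sup>2) * norm (V - W)"
proof (rule norm_X_le)
  fix x
  define A B where "A = field V x" and "B = field W x"
  have AB: "norm A \<le> r" "norm B \<le> r"
    using norm_field_le[of V x] norm_field_le[of W x] assms by (auto simp: A_def B_def)
  have "field (nonlin \<kappa> V - nonlin \<kappa> W) x
      = (\<kappa> + 1) *\<^sub>R (A - B) - (A ** transpose A ** A - B ** transpose B ** B)"
    by (simp add: minus_X.rep_eq nonlin.rep_eq A_def B_def algebra_simps)
  also have "norm \<dots> \<le> (\<kappa> + 1) * norm (A - B) + 3 * r\<^sup>2 * norm (A - B)"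
    using norm_cubic_diff_le[OF AB] assms(1) norm_triangle_ineq4
    by (smt (verit) norm_scaleR)
  also have "\<dots> = (\<kappa> + 1 + 3 * r\<^sup>2) * norm (A - B)" by (simp add: algebra_simps)
  also have "\<dots> \<le> (\<kappa> + 1 + 3 * r\<^sup>2) * norm (V - W)"
    using norm_field_le[of "V - W" x] assms(1)
    by (intro mult_left_mono) (simp_all add: minus_X.rep_eq A_def B_def)
  finally show "norm (field (nonlin \<kappa> V - nonlin \<kappa> W) x) \<le> (\<kappa> + 1 + 3 * r\<^sup>2) * norm (V - W)" .
qed

lemma continuous_on_nonlin:
  fixes W :: "'b::topological_space \<Rightarrow> 'm::finite X"
  assumes "\<kappa> \<ge> 0" and "\<And>s. s \<in> I \<Longrightarrow> norm (W s) \<le> r" and "continuous_on I W"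
  shows "continuous_on I (\<lambda>s. nonlin \<kappa> (W s))"
  unfolding continuous_on_def
proof
  fix s assume s: "s \<in> I"
  define c where "c = \<kappa> + 1 + 3 * r\<^sup>2"
  have "((\<lambda>s'. c * norm (W s' - W s)) \<longlongrightarrow> c * norm (W s - W s)) (at s within I)"
    using s assms(3) by (intro tendsto_intros) (auto simp: continuous_on_def)
  then have lim: "((\<lambda>s'. c * norm (W s' - W s)) \<longlongrightarrow> 0) (at s within I)" by simp
  have "\<forall>\<^sub>F s' in at s within I. norm (nonlin \<kappa> (W s') - nonlin \<kappa> (W s)) \<le> c * norm (W s' - W s)"
    unfolding eventually_at_filter c_def
    using nonlin_lipschitz[OF assms(1)] assms(2) s by (intro always_eventually) auto
  then have "((\<lambda>s'. nonlin \<kappa> (W s') - nonlin \<kappa> (W s)) \<longlongrightarrow> 0) (at s within I)"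
    by (rule Lim_null_comparison[OF _ lim])
  then show "((\<lambda>s. nonlin \<kappa> (W s)) \<longlongrightarrow> nonlin \<kappa> (W s)) (at s within I)"
    by (rule Lim_null[THEN iffD2])
qed

section \<open>Error propagation over one step\<close>

text \<open>
  The inhomogeneity is written as \<open>K\<close> times the growth rate, so that \<open>- K\<close> is the fixed point of the
  recursion and \<open>E n + K\<close> grows at most geometrically.
\<close>
lemma discrete_gronwall_linear:
  fixes E :: "nat \<Rightarrow> real"
  assumes "L \<ge> 0" and "\<tau> \<ge> 0" and "K \<ge> 0" and "E 0 \<le> 0"
    and step: "\<And>n. n < N \<Longrightarrow> E (Suc n) \<le> (1 + L * \<tau>) * E n + K * (L * \<tau>)"
    and "n \<le> N"
  shows "E n \<le> K * (exp (L * (real n * \<tau>)) - 1)"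
  using \<open>n \<le> N\<close>
proof (induction n)
  case 0
  then show ?case using assms(4) by simp
next
  case (Suc n)
  define x where "x = L * (real n * \<tau>)"
  have "E (Suc n) \<le> (1 + L * \<tau>) * E n + K * (L * \<tau>)"
    using step Suc.prems by simp
  also have "\<dots> \<le> (1 + L * \<tau>) * (K * (exp x - 1)) + K * (L * \<tau>)"
    using Suc assms by (intro add_right_mono mult_left_mono) (auto simp: x_def)
  also have "\<dots> = K * ((1 + L * \<tau>) * exp x - 1)" by (simp add: algebra_simps)
  also have "\<dots> \<le> K * (exp (L * \<tau>) * exp x - 1)"
    using assms exp_ge_add_one_self by (intro mult_left_mono diff_right_mono mult_right_mono) auto
  also have "exp (L * \<tau>) * exp x = exp (L * (real (Suc n) * \<tau>))"
    by (simp add: x_def exp_add[symmetric] algebra_simps)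
  finally show ?case .
qed

lemma C1_curve_lipschitz:
  assumes "T \<ge> 0" and C1: "C1_curve T U" and s: "s \<in> {0..T}" and t: "t \<in> {0..T}"
  shows "norm (U t - U s) \<le> C1_norm T U * \<bar>t - s\<bar>"
proof -
  define U' where "U' t = vector_derivative U (at t within {0..T})" for t
  have bdd: "bdd_above ((\<lambda>t. norm (f t)) ` {0..T})" if "continuous_on {0..T} f" for f :: "real \<Rightarrow> 'a"
    using that by (intro bounded_imp_bdd_above compact_imp_bounded compact_continuous_image
        continuous_on_norm) auto
  have deriv: "(U has_vector_derivative U' r) (at r within {0..T})" if "r \<in> {0..T}" for r
    using C1 that unfolding C1_curve_def U'_def by (simp add: vector_derivative_works[symmetric])
  have "continuous_on {0..T} U"
    using deriv has_vector_derivative_continuous by (force simp: continuous_on_eq_continuous_within)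
  then have "norm (U 0) \<le> (SUP t\<in>{0..T}. norm (U t))"
    using assms(1) by (intro cSUP_upper bdd) auto
  then have nonneg: "0 \<le> (SUP t\<in>{0..T}. norm (U t))" using norm_ge_zero order_trans by blast
  have U': "norm (U' r) \<le> C1_norm T U" if "r \<in> {0..T}" for r
  proof -
    have "norm (U' r) \<le> (SUP t\<in>{0..T}. norm (U' t))"
      using C1 that by (intro cSUP_upper bdd) (auto simp: C1_curve_def U'_def)
    then show ?thesis using nonneg by (simp add: C1_norm_def U'_def)
  qed
  have "norm (U t - U s) \<le> C1_norm T U * norm (t - s)"
  proof (rule differentiable_bound[where S = "{0..T}" and f' = "\<lambda>r h. h *\<^sub>R U' r"])
    show "(U has_derivative (\<lambda>h. h *\<^sub>R U' r)) (at r within {0..T})" if "r \<in> {0..T}" for r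
      using deriv[OF that] by (simp add: has_vector_derivative_def)
    show "onorm (\<lambda>h. h *\<^sub>R U' r) \<le> C1_norm T U" if "r \<in> {0..T}" for r
      using U'[OF that] nonneg
      by (intro onorm_bound) (auto simp: mult_left_mono mult.commute intro: order_trans[OF norm_ge_zero])
  qed (use s t in auto)
  then show ?thesis by simp
qed

text \<open>
  The exponential weight is kept on the part of the integrand proportional to \<open>\<kappa>\<close>: its integral
  \<open>1 - exp (- \<kappa> * \<tau>)\<close> is exactly what the damping over a step gains.
\<close>
lemma norm_integral_exp_bound:
  fixes f :: "real \<Rightarrow> 'a::banach"
  assumes "continuous_on {0..\<tau>} f" and "\<tau> \<ge> 0"
    and "\<And>s. s \<in> {0..\<tau>} \<Longrightarrow> norm (f s) \<le> \<kappa> * exp (- \<kappa> * (\<tau> - s)) * a + b + c * s"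
  shows "norm (integral {0..\<tau>} f) \<le> (1 - exp (- \<kappa> * \<tau>)) * a + b * \<tau> + c * \<tau>\<^sup>2 / 2"
proof -
  define F where "F s = exp (- \<kappa> * (\<tau> - s)) * a + b * s + c * s\<^sup>2 / 2" for s
  have "((\<lambda>s. \<kappa> * exp (- \<kappa> * (\<tau> - s)) * a + b + c * s) has_integral F \<tau> - F 0) {0..\<tau>}"
  proof (rule fundamental_theorem_of_calculus[OF \<open>\<tau> \<ge> 0\<close>])
    fix s
    show "(F has_vector_derivative \<kappa> * exp (- \<kappa> * (\<tau> - s)) * a + b + c * s) (at s within {0..\<tau>})"
      unfolding F_def has_real_derivative_iff_has_vector_derivative[symmetric]
      by (auto intro!: derivative_eq_intros)
  qed
  then have int: "(\<lambda>s. \<kappa> * exp (- \<kappa> * (\<tau> - s)) * a + b + c * s) integrable_on {0..\<tau>}"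
    and val: "integral {0..\<tau>} (\<lambda>s. \<kappa> * exp (- \<kappa> * (\<tau> - s)) * a + b + c * s) = F \<tau> - F 0"
    by (simp_all only: has_integral_iff)
  have "norm (integral {0..\<tau>} f)
      \<le> integral {0..\<tau>} (\<lambda>s. \<kappa> * exp (- \<kappa> * (\<tau> - s)) * a + b + c * s)"
    using integrable_continuous_interval[OF assms(1)] int assms(3)
    by (rule Henstock_Kurzweil_Integration.integral_norm_bound_integral)
  then have "norm (integral {0..\<tau>} f) \<le> F \<tau> - F 0" unfolding val .
  then show ?thesis by (simp add: F_def algebra_simps)
qed

context
  fixes S :: "real \<Rightarrow> 'm::finite X \<Rightarrow> 'm X"
  assumes S: "C0_semigroup S"
    and contr: "\<And>t w. t \<ge> 0 \<Longrightarrow> norm (S t w) \<le> norm w"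
begin

text \<open>
  Contractivity makes the operators equicontinuous, which upgrades strong continuity to joint
  continuity in time and argument. The integrals of the variation of constants formula therefore
  have continuous integrands.
\<close>
lemma continuous_on_semigroup:
  assumes r: "continuous_on I r" "r ` I \<subseteq> {0..}" and F: "continuous_on I F"
  shows "continuous_on I (\<lambda>s. S (r s) (F s))"
  unfolding continuous_on_def
proof
  fix s assume s: "s \<in> I"
  have "continuous_on I (\<lambda>s'. S (r s') (F s))"
    using continuous_on_compose2[OF semigroup_strongly_continuous[OF S] r] .
  then have 1: "((\<lambda>s'. S (r s') (F s)) \<longlongrightarrow> S (r s) (F s)) (at s within I)"
    using s by (auto simp: continuous_on_def)
  have "((\<lambda>s'. norm (F s' - F s)) \<longlongrightarrow> norm (F s - F s)) (at s within I)"
    using s F by (intro tendsto_intros) (auto simp: continuous_on_def)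
  then have lim: "((\<lambda>s'. norm (F s' - F s)) \<longlongrightarrow> 0) (at s within I)" by simp
  have "((\<lambda>s'. S (r s') (F s') - S (r s') (F s)) \<longlongrightarrow> 0) (at s within I)"
  proof (rule Lim_null_comparison[OF _ lim])
    have "norm (S (r s') (F s') - S (r s') (F s)) \<le> norm (F s' - F s)" if "s' \<in> I" for s'
    proof -
      interpret bounded_linear "S (r s')" using semigroup_bounded_linear[OF S] r(2) that by auto
      show ?thesis using contr[of "r s'" "F s' - F s"] r(2) that by (auto simp: diff)
    qed
    then show "\<forall>\<^sub>F s' in at s within I.
        norm (S (r s') (F s') - S (r s') (F s)) \<le> norm (F s' - F s)"
      unfolding eventually_at_filter by (intro always_eventually) auto
  qed
  from tendsto_add[OF this 1]
  show "((\<lambda>s. S (r s) (F s)) \<longlongrightarrow> S (r s) (F s)) (at s within I)" by simp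
qed

lemma bounded_linear_damped: "t \<ge> 0 \<Longrightarrow> bounded_linear (damped S \<kappa> t)"
  unfolding damped_def
  using bounded_linear_compose[OF bounded_linear_scaleR_right semigroup_bounded_linear[OF S]]
  by blast

lemma damped_add: "s \<ge> 0 \<Longrightarrow> t \<ge> 0 \<Longrightarrow> damped S \<kappa> (s + t) W = damped S \<kappa> s (damped S \<kappa> t W)"
proof -
  assume st: "s \<ge> 0" "t \<ge> 0"
  interpret bounded_linear "S s" using semigroup_bounded_linear[OF S] st by auto
  show ?thesis
    using st by (simp add: damped_def semigroup_add[OF S] scaleR exp_add[symmetric] algebra_simps)
qed

lemma norm_damped_le: "t \<ge> 0 \<Longrightarrow> norm (damped S \<kappa> t W) \<le> exp (- \<kappa> * t) * norm W"
  using contr by (simp add: damped_def)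

lemma continuous_on_damped:
  assumes "continuous_on I r" "r ` I \<subseteq> {0..}" "continuous_on I F"
  shows "continuous_on I (\<lambda>s. damped S \<kappa> (r s) (F s))"
  unfolding damped_def by (intro continuous_intros continuous_on_semigroup assms)

text \<open>
  A mild solution can be restarted: its value at time \<open>t\<close> is an initial value for the remaining
  time \<open>\<tau>\<close>. This puts the exact solution into the form of one step of the scheme.
\<close>
lemma mild_solution_restart:
  assumes G: "continuous_on {0..t + \<tau>} G" and t: "t \<ge> 0" and \<tau>: "\<tau> \<ge> 0"
    and Ut: "Ut = damped S \<kappa> t U0 + integral {0..t} (\<lambda>s. damped S \<kappa> (t - s) (G s))"
  shows "damped S \<kappa> (t + \<tau>) U0 + integral {0..t + \<tau>} (\<lambda>s. damped S \<kappa> (t + \<tau> - s) (G s))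
    = damped S \<kappa> \<tau> Ut + integral {0..\<tau>} (\<lambda>s. damped S \<kappa> (\<tau> - s) (G (t + s)))"
proof -
  define g where "g s = damped S \<kappa> (t + \<tau> - s) (G s)" for s
  interpret D: bounded_linear "damped S \<kappa> \<tau>" using bounded_linear_damped[OF \<tau>] .
  have "continuous_on {0..t} (\<lambda>s. damped S \<kappa> (t - s) (G s))"
    by (intro continuous_on_damped continuous_intros continuous_on_subset[OF G]) (use \<tau> in auto)
  then have int_t: "(\<lambda>s. damped S \<kappa> (t - s) (G s)) integrable_on {0..t}"
    by (rule integrable_continuous_interval)
  have "continuous_on {0..t + \<tau>} g"
    unfolding g_def by (intro continuous_on_damped continuous_intros G) auto
  then have "g integrable_on {0..t + \<tau>}" by (rule integrable_continuous_interval)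
  then have "integral {0..t + \<tau>} g = integral {0..t} g + integral {t..t + \<tau>} g"
    using t \<tau> by (simp add: Henstock_Kurzweil_Integration.integral_combine)
  also have "integral {0..t} g = integral {0..t} (damped S \<kappa> \<tau> \<circ> (\<lambda>s. damped S \<kappa> (t - s) (G s)))"
    by (rule integral_cong) (use \<tau> in \<open>simp add: g_def damped_add[symmetric] algebra_simps\<close>)
  also have "\<dots> = damped S \<kappa> \<tau> (integral {0..t} (\<lambda>s. damped S \<kappa> (t - s) (G s)))"
    by (rule integral_linear[OF int_t D.bounded_linear_axioms])
  also have "integral {t..t + \<tau>} g = integral {0..\<tau>} (g \<circ> (+) t)"
    by (simp add: integral_shift_Icc_real add.commute)
  also have "g \<circ> (+) t = (\<lambda>s. damped S \<kappa> (\<tau> - s) (G (t + s)))"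
    by (simp add: g_def fun_eq_iff)
  finally show ?thesis
    using damped_add[OF \<tau> t, of \<kappa> U0]
    by (simp add: g_def[abs_def] Ut D.add add.commute)
qed

text \<open>
  A step of the scheme damps the previous iterate by \<open>exp (- \<kappa> * \<tau>)\<close> and adds at most
  \<open>1 - exp (- \<kappa> * \<tau>)\<close> times the same bound, because the nonlinearity enlarges the bound by
  a factor of at most \<open>\<kappa>\<close>.
\<close>
lemma ETD1_norm_le:
  assumes \<kappa>: "\<kappa> \<ge> 2" and m: "real CARD('m) \<le> 2 * \<kappa>" and \<tau>: "\<tau> \<ge> 0"
    and U0: "norm U0 \<le> sqrt (real CARD('m))"
  shows "norm (ETD1 S \<kappa> \<tau> U0 n) \<le> sqrt (real CARD('m))"
proof (induction n)
  case 0
  then show ?case using U0 by simp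
next
  case (Suc n)
  define V where "V = ETD1 S \<kappa> \<tau> U0 n"
  define q where "q = sqrt (real CARD('m))"
  have V: "norm V \<le> q" using Suc by (simp add: V_def q_def)
  have NV: "norm (nonlin \<kappa> V) \<le> \<kappa> * q"
    using norm_nonlin_le[OF \<kappa> m] V by (simp add: q_def)
  have "norm (integral {0..\<tau>} (\<lambda>s. damped S \<kappa> (\<tau> - s) (nonlin \<kappa> V)))
      \<le> (1 - exp (- \<kappa> * \<tau>)) * q + 0 * \<tau> + 0 * \<tau>\<^sup>2 / 2"
  proof (rule norm_integral_exp_bound[OF _ \<tau>])
    show "continuous_on {0..\<tau>} (\<lambda>s. damped S \<kappa> (\<tau> - s) (nonlin \<kappa> V))"
      by (intro continuous_on_damped continuous_intros) auto
    fix s assume "s \<in> {0..\<tau>}"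
    then have "norm (damped S \<kappa> (\<tau> - s) (nonlin \<kappa> V)) \<le> exp (- \<kappa> * (\<tau> - s)) * norm (nonlin \<kappa> V)"
      by (intro norm_damped_le) simp
    also have "\<dots> \<le> exp (- \<kappa> * (\<tau> - s)) * (\<kappa> * q)" using NV by (intro mult_left_mono) auto
    finally show "norm (damped S \<kappa> (\<tau> - s) (nonlin \<kappa> V))
        \<le> \<kappa> * exp (- \<kappa> * (\<tau> - s)) * q + 0 + 0 * s" by (simp add: mult_ac)
  qed
  moreover have "norm (damped S \<kappa> \<tau> V) \<le> exp (- \<kappa> * \<tau>) * q"
    by (rule order_trans[OF norm_damped_le[OF \<tau>] mult_left_mono[OF V]]) simp
  ultimately have "norm (damped S \<kappa> \<tau> V + integral {0..\<tau>} (\<lambda>s. damped S \<kappa> (\<tau> - s) (nonlin \<kappa> V)))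
      \<le> exp (- \<kappa> * \<tau>) * q + (1 - exp (- \<kappa> * \<tau>)) * q"
    by (intro norm_triangle_mono) auto
  also have "\<dots> = q" by (simp add: algebra_simps)
  finally show ?case by (simp add: V_def q_def)
qed

text \<open>
  Here \<open>V\<close> is the iterate and \<open>W s\<close> the exact solution at time \<open>s\<close> after the start of the step.
  In the bound \<open>(\<kappa> + L) * (norm (V - W 0) + C * s)\<close> on the difference of the nonlinear terms the
  exponential weight is used only for the part \<open>\<kappa> * norm (V - W 0)\<close>, where it offsets the
  contribution of \<open>\<kappa>\<close> to the growth factor; elsewhere it is estimated by \<open>1\<close>.
\<close>
lemma ETD1_error_step:
  assumes \<kappa>: "\<kappa> \<ge> 0" and L: "L \<ge> 1 + 3 * r\<^sup>2" and \<tau>: "\<tau> \<ge> 0"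
    and V: "norm V \<le> r" and W: "\<And>s. s \<in> {0..\<tau>} \<Longrightarrow> norm (W s) \<le> r"
    and contW: "continuous_on {0..\<tau>} W"
    and lip: "\<And>s. s \<in> {0..\<tau>} \<Longrightarrow> norm (W s - W 0) \<le> C * s" and C: "C \<ge> 0"
  shows "norm ((damped S \<kappa> \<tau> V + integral {0..\<tau>} (\<lambda>s. damped S \<kappa> (\<tau> - s) (nonlin \<kappa> V)))
      - (damped S \<kappa> \<tau> (W 0) + integral {0..\<tau>} (\<lambda>s. damped S \<kappa> (\<tau> - s) (nonlin \<kappa> (W s)))))
    \<le> (1 + L * \<tau>) * norm (V - W 0) + (\<kappa> + L) * C * \<tau>\<^sup>2 / 2"
proof -
  define e where "e = norm (V - W 0)"
  interpret D: bounded_linear "damped S \<kappa> \<tau>" using bounded_linear_damped[OF \<tau>] .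
  have L0: "L \<ge> 0" using L by (smt (verit) zero_le_power2)
  have lip_N: "norm (nonlin \<kappa> A - nonlin \<kappa> B) \<le> (\<kappa> + L) * norm (A - B)"
    if "norm A \<le> r" "norm B \<le> r" for A B :: "'m X"
  proof -
    have "norm (nonlin \<kappa> A - nonlin \<kappa> B) \<le> (\<kappa> + 1 + 3 * r\<^sup>2) * norm (A - B)"
      by (rule nonlin_lipschitz[OF \<kappa> that])
    also have "\<dots> \<le> (\<kappa> + L) * norm (A - B)" using L by (intro mult_right_mono) auto
    finally show ?thesis .
  qed
  have contN: "continuous_on {0..\<tau>} (\<lambda>s. nonlin \<kappa> (W s))"
    by (rule continuous_on_nonlin[OF \<kappa> W contW])
  define f where "f s = damped S \<kappa> (\<tau> - s) (nonlin \<kappa> V - nonlin \<kappa> (W s))" for s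
  have contd: "continuous_on {0..\<tau>} (\<lambda>s. damped S \<kappa> (\<tau> - s) (F s))"
    if "continuous_on {0..\<tau>} F" for F
    by (rule continuous_on_damped[OF _ _ that]) (intro continuous_intros, auto)
  have cont: "continuous_on {0..\<tau>} (\<lambda>s. damped S \<kappa> (\<tau> - s) (nonlin \<kappa> V))"
     "continuous_on {0..\<tau>} (\<lambda>s. damped S \<kappa> (\<tau> - s) (nonlin \<kappa> (W s)))"
     "continuous_on {0..\<tau>} f"
    unfolding f_def
    by (rule contd, rule continuous_on_const, rule contd[OF contN],
        rule contd[OF continuous_on_diff[OF continuous_on_const contN]])
  have "norm (integral {0..\<tau>} f) \<le> (1 - exp (- \<kappa> * \<tau>)) * e + (L * e) * \<tau> + ((\<kappa> + L) * C) * \<tau>\<^sup>2 / 2"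
  proof (rule norm_integral_exp_bound[OF cont(3) \<tau>])
    fix s assume s: "s \<in> {0..\<tau>}"
    define x where "x = exp (- \<kappa> * (\<tau> - s))"
    have x: "0 \<le> x" "x \<le> 1" using s \<kappa> by (auto simp: x_def)
    have "norm (V - W s) \<le> norm (V - W 0) + norm (W s - W 0)"
      using norm_triangle_ineq4[of "V - W 0" "W s - W 0"] by simp
    also have "\<dots> \<le> e + C * s" using lip[OF s] by (simp add: e_def)
    finally have "norm (V - W s) \<le> e + C * s" .
    have "norm (f s) \<le> x * norm (nonlin \<kappa> V - nonlin \<kappa> (W s))"
      unfolding f_def x_def using s by (intro norm_damped_le) simp
    also have "\<dots> \<le> x * ((\<kappa> + L) * norm (V - W s))"
      using x lip_N[OF V W[OF s]] by (intro mult_left_mono) auto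
    also have "\<dots> \<le> x * ((\<kappa> + L) * (e + C * s))"
      using x \<kappa> L0 \<open>norm (V - W s) \<le> e + C * s\<close> by (intro mult_left_mono) auto
    also have "\<dots> = \<kappa> * x * e + x * (L * e + (\<kappa> + L) * C * s)"
      by (simp add: algebra_simps)
    also have "\<dots> \<le> \<kappa> * x * e + 1 * (L * e + (\<kappa> + L) * C * s)"
      using x \<kappa> L0 C s by (intro add_left_mono mult_right_mono) (auto simp: e_def)
    finally show "norm (f s) \<le> \<kappa> * exp (- \<kappa> * (\<tau> - s)) * e + L * e + (\<kappa> + L) * C * s"
      by (simp add: x_def)
  qed
  moreover have "norm (damped S \<kappa> \<tau> (V - W 0)) \<le> exp (- \<kappa> * \<tau>) * e"
    unfolding e_def by (rule norm_damped_le[OF \<tau>])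
  ultimately have bound: "norm (damped S \<kappa> \<tau> (V - W 0) + integral {0..\<tau>} f)
      \<le> (1 + L * \<tau>) * e + (\<kappa> + L) * C * \<tau>\<^sup>2 / 2"
    by (intro order_trans[OF norm_triangle_ineq]) (simp add: algebra_simps)
  have "integral {0..\<tau>} f = integral {0..\<tau>} (\<lambda>s. damped S \<kappa> (\<tau> - s) (nonlin \<kappa> V)
      - damped S \<kappa> (\<tau> - s) (nonlin \<kappa> (W s)))"
    by (rule integral_cong) (simp add: f_def linear_diff bounded_linear.linear[OF bounded_linear_damped])
  also have "\<dots> = integral {0..\<tau>} (\<lambda>s. damped S \<kappa> (\<tau> - s) (nonlin \<kappa> V))
      - integral {0..\<tau>} (\<lambda>s. damped S \<kappa> (\<tau> - s) (nonlin \<kappa> (W s)))"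
    by (intro integral_diff integrable_continuous_interval cont)
  finally have "damped S \<kappa> \<tau> (V - W 0) + integral {0..\<tau>} f
    = (damped S \<kappa> \<tau> V + integral {0..\<tau>} (\<lambda>s. damped S \<kappa> (\<tau> - s) (nonlin \<kappa> V)))
      - (damped S \<kappa> \<tau> (W 0) + integral {0..\<tau>} (\<lambda>s. damped S \<kappa> (\<tau> - s) (nonlin \<kappa> (W s))))"
    by (simp add: D.diff)
  then show ?thesis using bound by (simp only: e_def)
qed

end

section \<open>The error estimate\<close>

theorem theorem3p5:
  fixes \<epsilon> \<kappa> T :: real
    and S :: "real \<Rightarrow> 'm::finite X \<Rightarrow> 'm X"
    and U0 :: "'m X"
    and U :: "real \<Rightarrow> 'm X"
  assumes "CARD('m) \<ge> 2"
    and "\<epsilon> > 0"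
    and "\<kappa> \<ge> max (3/2 * real CARD('m) - 1) 2"
    and "T > 0"
    and "generates (L_op \<epsilon>) S"
    and "norm U0 \<le> sqrt (real CARD('m))"
    and "exact_solution S \<kappa> T U0 U"
    and "C1_curve T U"
  shows "\<forall>\<tau>>0. \<forall>n. real n * \<tau> \<le> T \<longrightarrow>
    norm (ETD1 S \<kappa> \<tau> U0 n - U (real n * \<tau>))
      \<le> C1_norm T U * real CARD('m) * (\<kappa> / (1 + 5 * real CARD('m)) + 1)
          * exp ((1 + 5 * real CARD('m)) * (real n * \<tau>)) * \<tau>"
proof (intro allI impI)
  fix \<tau> :: real and n :: nat
  assume \<tau>: "\<tau> > 0" and nT: "real n * \<tau> \<le> T"
  define m where "m = real CARD('m)"
  define q where "q = sqrt m"
  define L where "L = 1 + 5 * m"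
  define C where "C = C1_norm T U"
  define t where "t k = real k * \<tau>" for k
  define V where "V k = ETD1 S \<kappa> \<tau> U0 k" for k
  have m: "m \<ge> 2" using assms(1) by (simp add: m_def)
  have \<kappa>: "\<kappa> \<ge> 2" "m \<le> 2 * \<kappa>" using assms(3) m by (auto simp: m_def)
  have L: "L > 0" "1 + 3 * q\<^sup>2 \<le> L" using m by (auto simp: L_def q_def)
  have S: "C0_semigroup S" and gen: "generator S = L_op \<epsilon>"
    using assms(5) by (auto simp: generates_def)
  have contr: "norm (S r w) \<le> norm w" if "r \<ge> 0" for r w
    using dissipative_generator_imp_contraction[OF S _ that] gen dissipative_L_op by metis
  have contU: "continuous_on {0..T} U" and U_le: "\<And>r. r \<in> {0..T} \<Longrightarrow> norm (U r) \<le> q"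
    and U_eq: "\<And>r. r \<in> {0..T} \<Longrightarrow> U r = damped S \<kappa> r U0
        + integral {0..r} (\<lambda>s. damped S \<kappa> (r - s) (nonlin \<kappa> (U s)))"
    using assms(7) by (auto simp: exact_solution_def q_def m_def)
  have lip: "norm (U b - U a) \<le> C * \<bar>b - a\<bar>" if "a \<in> {0..T}" "b \<in> {0..T}" for a b
    unfolding C_def by (rule C1_curve_lipschitz[OF _ assms(8) that]) (use assms(4) in simp)
  have "0 \<le> C * \<bar>T - 0\<bar>" by (rule order_trans[OF norm_ge_zero lip]) (use assms(4) in auto)
  then have C: "C \<ge> 0" using assms(4) by (simp add: zero_le_mult_iff)
  have V_le: "norm (V k) \<le> q" for k
    unfolding V_def q_def m_def
    by (rule ETD1_norm_le[OF S contr]) (use \<kappa> \<tau> assms(6) in \<open>auto simp: m_def\<close>)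
  \<comment> \<open>The consistency error of one step, divided by the growth rate \<open>L * \<tau>\<close>.\<close>
  define K where "K = (\<kappa> / L + 1) * C * \<tau> / 2"
  have K: "K \<ge> 0" using C \<kappa> L \<tau> by (simp add: K_def)
  have "norm (V n - U (t n)) \<le> K * (exp (L * (real n * \<tau>)) - 1)"
  proof (rule discrete_gronwall_linear[where N = n and E = "\<lambda>k. norm (V k - U (t k))"])
    show "norm (V 0 - U (t 0)) \<le> 0"
      using U_eq[of 0] assms(4) by (simp add: V_def t_def damped_def semigroup_zero[OF S])
    fix k assume "k < n"
    then have "t k + \<tau> \<le> t n"
      using \<tau> mult_right_mono[of "real (Suc k)" "real n" \<tau>] by (simp add: t_def algebra_simps)
    then have tk: "0 \<le> t k" "t k + \<tau> \<le> T" using nT \<tau> by (auto simp: t_def)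
    have sub: "t k + s \<in> {0..T}" if "s \<in> {0..\<tau>}" for s using that tk by auto
    define W where "W s = U (t k + s)" for s
    have contNU: "continuous_on {0..t k + \<tau>} (\<lambda>s. nonlin \<kappa> (U s))"
      by (rule continuous_on_nonlin[where r = q])
        (use \<kappa> U_le tk \<tau> in \<open>auto intro: continuous_on_subset[OF contU]\<close>)
    have "t (Suc k) = t k + \<tau>" by (simp add: t_def algebra_simps)
    then have "U (t (Suc k)) = damped S \<kappa> (t k + \<tau>) U0
        + integral {0..t k + \<tau>} (\<lambda>s. damped S \<kappa> (t k + \<tau> - s) (nonlin \<kappa> (U s)))"
      using U_eq[of "t k + \<tau>"] tk \<tau> by simp
    also have "\<dots> = damped S \<kappa> \<tau> (W 0) + integral {0..\<tau>} (\<lambda>s. damped S \<kappa> (\<tau> - s) (nonlin \<kappa> (W s)))"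
      unfolding W_def
      by (rule mild_solution_restart[OF S contr contNU]) (use tk \<tau> U_eq[of "t k"] in auto)
    finally have U_Suc: "U (t (Suc k)) = damped S \<kappa> \<tau> (W 0)
        + integral {0..\<tau>} (\<lambda>s. damped S \<kappa> (\<tau> - s) (nonlin \<kappa> (W s)))" .
    have "norm (V (Suc k) - U (t (Suc k)))
        \<le> (1 + L * \<tau>) * norm (V k - W 0) + (\<kappa> + L) * C * \<tau>\<^sup>2 / 2"
      unfolding U_Suc V_def ETD1.simps
    proof (rule ETD1_error_step[OF S contr])
      show "norm (ETD1 S \<kappa> \<tau> U0 k) \<le> q" using V_le by (simp add: V_def)
      have "continuous_on {0..\<tau>} (\<lambda>s. t k + s)" by (intro continuous_intros)
      then show "continuous_on {0..\<tau>} W"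
        unfolding W_def by (rule continuous_on_compose2[OF contU]) (use sub in blast)
      show "norm (W s) \<le> q" if "s \<in> {0..\<tau>}" for s using U_le[OF sub[OF that]] by (simp add: W_def)
      show "norm (W s - W 0) \<le> C * s" if "s \<in> {0..\<tau>}" for s
        using lip[OF sub[of 0] sub[OF that]] that by (simp add: W_def)
    qed (use \<kappa> L \<tau> C in auto)
    also have "W 0 = U (t k)" by (simp add: W_def)
    also have "(\<kappa> + L) * C * \<tau>\<^sup>2 / 2 = K * (L * \<tau>)"
      using L by (simp add: K_def field_simps power2_eq_square)
    finally show "norm (V (Suc k) - U (t (Suc k))) \<le> (1 + L * \<tau>) * norm (V k - U (t k)) + K * (L * \<tau>)" .
  qed (use L \<tau> K in auto)
  also have "\<dots> \<le> 2 * m * K * exp (L * (real n * \<tau>))"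
  proof -
    have "K * (exp (L * (real n * \<tau>)) - 1) \<le> K * exp (L * (real n * \<tau>))"
      using K by (intro mult_left_mono) auto
    also have "\<dots> \<le> 2 * m * K * exp (L * (real n * \<tau>))"
      using K m mult_right_mono[of 1 "2 * m" K] by (intro mult_right_mono) auto
    finally show ?thesis .
  qed
  also have "\<dots> = C * m * (\<kappa> / L + 1) * exp (L * (real n * \<tau>)) * \<tau>"
    by (simp add: K_def)
  finally show "norm (ETD1 S \<kappa> \<tau> U0 n - U (real n * \<tau>))
      \<le> C1_norm T U * real CARD('m) * (\<kappa> / (1 + 5 * real CARD('m)) + 1)
          * exp ((1 + 5 * real CARD('m)) * (real n * \<tau>)) * \<tau>"
    by (simp add: V_def t_def C_def m_def L_def)
qed

end
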